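(* Let $M$ be a vf-safe $\Delta$-matroid on ground set $V$. Define $P=\{v\in V: v\text{ is not a coloop of }\max(M+V+v)\}$, $Q=\{v\in V: v\text{ is not a coloop of }\max(M+V*v)\}$, and $R=\{v\in V: v\text{ is not a coloop of }\max(M+V)\}$. Then every element of $V$ belongs to exactly one of $P,Q,R$. Moreover, if $M$ is a binary matroid, then $P=P_0$, $Q=Q_0$, $R=R_0$, where $P_0=\{v\in V\mid \exists X\in\mathcal{CS}_M,\ v\in X,\ X\setminus\{v\}\in\mathcal{CS}_M^\perp\}$, $Q_0=\{v\in V\mid\exists X\in\mathcal{CS}_M^\perp,\ v\in X,\ X\setminus\{v\}\in\mathcal{CS}_M\}$, and $R_0=\{v\in V\mid \exists X\in\mathcal{CS}_M\cap\mathcal{CS}_M^\perp,\ v\in X\}$.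
   Context: A set system is $N=(V,D)$ with $V$ finite, $D\subseteq 2^V$; proper if $D\neq\emptyset$. Twist $N*X=(V,\{Y\triangle X:Y\in D\})$; loop complementation $N+X=(V,D')$ with $Y\in D'$ iff the number of $Z\in D$ with $Y\setminus X\subseteq Z\subseteq Y$ is odd. For $v\in V$, $N*v=N*\{v\}$, $N+v=N+\{v\}$. Operations are applied left to right, so $M+V+v=M+(V\setminus\{v\})$ and $M+V*v=(M+V)*\{v\}$. $\max(N)$ is $(V,\text{inclusion-maximal members of }D)$. A $\Delta$-matroid is a proper set system such that for all $X,Y\in D$, $x\in X\triangle Y$ there is $y\in X\triangle Y$ (possibly $y=x$) with $X\triangle\{x,y\}\in D$; it is vf-safe if every set system obtained from it by finite sequences of twists and loop complementations is a $\Delta$-matroid. Matroids are identified with the set systems of their bases (binary matroids are vf-safe); a coloop of a matroid is an element in every basis. For a binary matroid $M$, $\mathcal{CS}_M\subseteq\mathrm{GF}(2)^V$ is the span of the circuits' incidence vectors, $\mathcal{CS}_M^\perp$ its orthogonal complement under the standard bilinear form, and vectors are identified with their supports. *)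

theory Defs
  imports Complex_Main "HOL-Library.Z2" "HOL-Library.Function_Algebras"
begin

type_synonym 'a set_system = "'a set \<times> 'a set set"

abbreviation ground :: "'a set_system \<Rightarrow> 'a set" where
  "ground N \<equiv> fst N"

abbreviation members :: "'a set_system \<Rightarrow> 'a set set" where
  "members N \<equiv> snd N"

definition set_system :: "'a set_system \<Rightarrow> bool" where
  "set_system N \<longleftrightarrow> finite (ground N) \<and> members N \<subseteq> Pow (ground N)"

definition proper :: "'a set_system \<Rightarrow> bool" where
  "proper N \<longleftrightarrow> members N \<noteq> {}"

definition symdiff :: "'a set \<Rightarrow> 'a set \<Rightarrow> 'a set" where
  "symdiff X Y = (X - Y) \<union> (Y - X)"

definition twist :: "'a set_system \<Rightarrow> 'a set \<Rightarrow> 'a set_system" where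
  "twist N X = (ground N, {symdiff Y X | Y. Y \<in> members N})"

definition loop_compl :: "'a set_system \<Rightarrow> 'a set \<Rightarrow> 'a set_system" where
  "loop_compl N X =
     (ground N, {Y. Y \<subseteq> ground N \<and> odd (card {Z \<in> members N. Y - X \<subseteq> Z \<and> Z \<subseteq> Y})})"

definition max_members :: "'a set_system \<Rightarrow> 'a set_system" where
  "max_members N = (ground N, {Y \<in> members N. \<forall>Z \<in> members N. Y \<subseteq> Z \<longrightarrow> Z = Y})"

definition delta_matroid :: "'a set_system \<Rightarrow> bool" where
  "delta_matroid N \<longleftrightarrow> set_system N \<and> proper N \<and>
     (\<forall>X \<in> members N. \<forall>Y \<in> members N. \<forall>x \<in> symdiff X Y.
        \<exists>y \<in> symdiff X Y. symdiff X {x, y} \<in> members N)"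

inductive vf_reachable :: "'a set_system \<Rightarrow> 'a set_system \<Rightarrow> bool" for M where
  refl: "vf_reachable M M"
| twist: "vf_reachable M N \<Longrightarrow> X \<subseteq> ground M \<Longrightarrow> vf_reachable M (twist N X)"
| loop_compl: "vf_reachable M N \<Longrightarrow> X \<subseteq> ground M \<Longrightarrow> vf_reachable M (loop_compl N X)"

definition vf_safe :: "'a set_system \<Rightarrow> bool" where
  "vf_safe M \<longleftrightarrow> (\<forall>N. vf_reachable M N \<longrightarrow> delta_matroid N)"

definition matroid :: "'a set_system \<Rightarrow> bool" where
  "matroid M \<longleftrightarrow> set_system M \<and> proper M \<and>
     (\<forall>A \<in> members M. \<forall>B \<in> members M. \<forall>x \<in> A - B.
        \<exists>y \<in> B - A. insert y (A - {x}) \<in> members M)"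

definition coloop :: "'a set_system \<Rightarrow> 'a \<Rightarrow> bool" where
  "coloop M v \<longleftrightarrow> v \<in> ground M \<and> (\<forall>B \<in> members M. v \<in> B)"

definition matroid_indep :: "'a set_system \<Rightarrow> 'a set \<Rightarrow> bool" where
  "matroid_indep M I \<longleftrightarrow> (\<exists>B \<in> members M. I \<subseteq> B)"

definition circuit :: "'a set_system \<Rightarrow> 'a set \<Rightarrow> bool" where
  "circuit M C \<longleftrightarrow> C \<subseteq> ground M \<and> \<not> matroid_indep M C \<and> (\<forall>I. I \<subset> C \<longrightarrow> matroid_indep M I)"

definition gf2_scale :: "bit \<Rightarrow> ('i \<Rightarrow> bit) \<Rightarrow> 'i \<Rightarrow> bit" where
  "gf2_scale c x = (\<lambda>i. c * x i)"

lemma vector_space_gf2: "vector_space (gf2_scale :: bit \<Rightarrow> ('i \<Rightarrow> bit) \<Rightarrow> 'i \<Rightarrow> bit)"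
  by unfold_locales
    (simp_all only: gf2_scale_def fun_eq_iff plus_fun_apply distrib_left distrib_right mult.assoc
      mult_1_left simp_thms)

text \<open>
  The column \<open>A v\<close> of the matrix \<open>A\<close> is indexed by the ground set element \<open>v\<close>. Columns are treated
  as a family rather than a set, so equal columns of distinct elements are dependent; hence the
  injectivity condition.
\<close>

definition columns_indep :: "('a \<Rightarrow> nat \<Rightarrow> bit) \<Rightarrow> 'a set \<Rightarrow> bool" where
  "columns_indep A I \<longleftrightarrow> inj_on A I \<and> \<not> module.dependent gf2_scale (A ` I)"

text \<open>
  Columns lie in the space of vectors indexed by \<open>nat\<close>; those of a matrix with \<open>n\<close> rows are the ones
  vanishing from position \<open>n\<close> on.
\<close>

definition binary_matroid :: "'a set_system \<Rightarrow> bool" where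
  "binary_matroid M \<longleftrightarrow> matroid M \<and>
     (\<exists>n A. (\<forall>v \<in> ground M. \<forall>i \<ge> n. A v i = 0) \<and>
        (\<forall>I. I \<subseteq> ground M \<longrightarrow> (matroid_indep M I \<longleftrightarrow> columns_indep A I)))"

definition incidence :: "'a set \<Rightarrow> 'a \<Rightarrow> bit" where
  "incidence X = (\<lambda>v. of_bool (v \<in> X))"

text \<open>
  Vectors over the ground set are represented by their supports, so both spaces below are families
  of subsets of the ground set.
\<close>

definition cycle_space :: "'a set_system \<Rightarrow> 'a set set" where
  "cycle_space M =
     {X. X \<subseteq> ground M \<and> incidence X \<in> module.span gf2_scale (incidence ` {C. circuit M C})}"

definition orth_compl :: "'a set \<Rightarrow> 'a set set \<Rightarrow> 'a set set" where
  "orth_compl V S =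
     {X. X \<subseteq> V \<and> (\<forall>Y \<in> S. (\<Sum>v\<in>V. incidence X v * incidence Y v) = 0)}"

end

theory Submission imports Defs "HOL-Library.Product_Plus" begin

text \<open>
  Put \<open>N = M + V\<close> and fix \<open>v\<close>. Let \<open>f\<close> and \<open>g\<close> be the families of sets \<open>Y\<close> avoiding \<open>v\<close> with
  \<open>Y \<in> N\<close>, respectively \<open>Y \<union> {v} \<in> N\<close>; the operations \<open>* v\<close> and \<open>+ v\<close> permute \<open>f\<close>, \<open>g\<close> and their
  symmetric difference \<open>h\<close>. As the maximal members of a \<open>\<Delta>\<close>-matroid are equicardinal, \<open>v\<close> lies in
  \<open>R\<close>, \<open>Q\<close>, \<open>P\<close> according to which of \<open>g\<close>, \<open>f\<close>, \<open>h\<close> has strictly smaller maximal cardinality. If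
  \<open>f\<close> and \<open>g\<close> have the same maximal cardinality, the exchange axiom forces their top levels to
  coincide, so these cancel in \<open>h\<close>.

  For binary \<open>M\<close> let \<open>L\<close> be the Lagrangian subspace of all pairs of a cocycle and a cycle, viewed as
  maps from \<open>V\<close> to the symplectic plane over GF(2). Choosing one nonzero vector of the plane at each
  element gives a coordinate Lagrangian, and the bases are the choices between \<open>(1, 0)\<close> and \<open>(0, 1)\<close>
  whose coordinate Lagrangian meets \<open>L\<close> trivially. Twists and loop complementations only relabel the
  vectors being chosen. A vector of \<open>L\<close> which is nonzero at \<open>v\<close> and takes values in \<open>{0, (1, 1)}\<close>
  elsewhere always exists; its value at \<open>v\<close> decides between \<open>P\<^sub>0\<close>, \<open>Q\<^sub>0\<close>, \<open>R\<^sub>0\<close>, and a pivot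
  along \<open>L\<close> shows that \<open>v\<close> is avoided by some maximal member of the corresponding set system.
\<close>

subsection \<open>Delta-matroids\<close>

lemma delta_matroid_finite_members:
  assumes "delta_matroid N"
  shows "finite (members N)" and "Y \<in> members N \<Longrightarrow> finite Y"
  using assms unfolding delta_matroid_def set_system_def
  by (auto intro: finite_subset)

text \<open>Among the members larger than \<open>X\<close>, one closest to \<open>X\<close> is
  exchanged towards \<open>X\<close>. The result is no smaller, gains an element of \<open>X\<close>
  and loses none of them, so it is closer still.\<close>

lemma delta_matroid_max_card:
  assumes N: "delta_matroid N" and X: "X \<in> members (max_members N)" and Y: "Y \<in> members N"
  shows "card Y \<le> card X"
proof (rule ccontr)
  assume "\<not> card Y \<le> card X"
  then have ex: "Y \<in> members N \<and> card X < card Y" using Y by simp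
  define Y0 where "Y0 = (ARG_MIN (\<lambda>Y. card (X - Y)) Y. Y \<in> members N \<and> card X < card Y)"
  have Y0: "Y0 \<in> members N" "card X < card Y0"
    and min: "\<And>Z. Z \<in> members N \<Longrightarrow> card X < card Z \<Longrightarrow> card (X - Y0) \<le> card (X - Z)"
    using arg_min_nat_lemma[where P = "\<lambda>Y. Y \<in> members N \<and> card X < card Y", OF ex,
        where m = "\<lambda>Y. card (X - Y)"]
    unfolding Y0_def by blast+
  have XN: "X \<in> members N" and maxX: "\<And>Z. Z \<in> members N \<Longrightarrow> X \<subseteq> Z \<Longrightarrow> Z = X"
    using X by (auto simp: max_members_def)
  have fin: "finite X" "finite Y0" using delta_matroid_finite_members(2)[OF N] XN Y0 by auto
  have "\<not> X \<subseteq> Y0" using maxX[OF Y0(1)] Y0(2) by auto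
  then obtain x where x: "x \<in> X" "x \<notin> Y0" by auto
  then obtain y where y: "y \<in> symdiff Y0 X" "symdiff Y0 {x, y} \<in> members N"
    using N XN Y0(1) unfolding delta_matroid_def by (metis DiffI UnI2 symdiff_def)
  let ?Z = "symdiff Y0 {x, y}"
  have "card Y0 \<le> card ?Z"
  proof (cases "y \<in> Y0")
    case True
    then have "?Z = insert x (Y0 - {y})" using x by (auto simp: symdiff_def)
    then show ?thesis using True x fin by (simp add: card_Diff_singleton card_gt_0_iff)
  next
    case False
    then have "Y0 \<subseteq> ?Z" using x by (auto simp: symdiff_def)
    then show ?thesis using fin by (intro card_mono) (auto simp: symdiff_def)
  qed
  moreover have "X - ?Z \<subset> X - Y0" using x y(1) by (auto simp: symdiff_def)
  then have "card (X - ?Z) < card (X - Y0)" using fin by (intro psubset_card_mono) auto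
  ultimately show False using min[OF y(2)] Y0(2) by simp
qed

text \<open>Passes from inclusion to cardinality: a member of largest size is inclusion-maximal
  since members are finite, and the converse is the equicardinality just shown.\<close>

lemma not_coloop_max_iff:
  assumes N: "delta_matroid N" and v: "v \<in> ground N"
  shows "\<not> coloop (max_members N) v \<longleftrightarrow>
    (\<exists>Y \<in> members N. v \<notin> Y \<and> (\<forall>Z \<in> members N. card Z \<le> card Y))"
proof -
  have "Y \<in> members (max_members N)"
    if "Y \<in> members N" "\<forall>Z \<in> members N. card Z \<le> card Y" for Y
    using that delta_matroid_finite_members(2)[OF N]
    by (auto simp: max_members_def) (metis card_seteq)+
  moreover have "Y \<in> members N" if "Y \<in> members (max_members N)" for Y
    using that by (auto simp: max_members_def)
  moreover have "v \<in> ground (max_members N)" using v by (simp add: max_members_def)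
  ultimately show ?thesis
    using delta_matroid_max_card[OF N] unfolding coloop_def by blast
qed

text \<open>\<open>insert v Y\<close> can be moved towards \<open>X\<close> by exchanges that
  keep \<open>v\<close>, since all other exchanges would exceed the maximal cardinality.\<close>

lemma delta_matroid_insert_top:
  assumes N: "delta_matroid N"
    and X: "X \<in> members N" "v \<notin> X" "card X = r"
    and Y: "insert v Y \<in> members N" "v \<notin> Y" "card Y = r"
    and top0: "\<And>Z. Z \<in> members N \<Longrightarrow> v \<notin> Z \<Longrightarrow> card Z \<le> r"
    and top1: "\<And>Z. Z \<in> members N \<Longrightarrow> card Z \<le> Suc r"
  shows "insert v X \<in> members N"
  using Y
proof (induction "card (X - Y)" arbitrary: Y rule: less_induct)
  case less
  have fin: "finite X" "finite Y"
    using delta_matroid_finite_members(2)[OF N X(1)]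
      delta_matroid_finite_members(2)[OF N less.prems(1)] by auto
  show ?case
  proof (cases "X \<subseteq> Y")
    case True
    then show ?thesis using card_subset_eq[OF fin(2) True] X less.prems by simp
  next
    case False
    then obtain x where x: "x \<in> X" "x \<notin> Y" by auto
    then have "x \<in> symdiff (insert v Y) X" using X by (auto simp: symdiff_def)
    then obtain y where y: "y \<in> symdiff (insert v Y) X" "symdiff (insert v Y) {x, y} \<in> members N"
      using N X(1) less.prems(1) unfolding delta_matroid_def by blast
    have xv: "x \<noteq> v" using x X by auto
    \<comment> \<open>Trading \<open>v\<close> for \<open>x\<close> would give a member with
      \<open>r + 1\<close> elements that avoids \<open>v\<close>.\<close>
    have "y \<noteq> v"
    proof
      assume "y = v"
      then have "symdiff (insert v Y) {x, y} = insert x Y"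
        using x xv less.prems(2) by (auto simp: symdiff_def)
      then show False using y(2) top0[of "insert x Y"] x xv less.prems fin by auto
    qed
    \<comment> \<open>Otherwise nothing is removed, and the result has at least \<open>r + 2\<close>
      elements.\<close>
    have "y \<in> Y"
    proof (rule ccontr)
      assume "y \<notin> Y"
      then have sub: "insert x (insert v Y) \<subseteq> symdiff (insert v Y) {x, y}"
        using x xv \<open>y \<noteq> v\<close> by (auto simp: symdiff_def)
      have "finite (symdiff (insert v Y) {x, y})" using fin by (auto simp: symdiff_def)
      from card_mono[OF this sub] show False
        using x xv less.prems fin top1[OF y(2)] by simp
    qed
    define Y' where "Y' = insert x (Y - {y})"
    have eq: "symdiff (insert v Y) {x, y} = insert v Y'"
      using x xv \<open>y \<noteq> v\<close> \<open>y \<in> Y\<close> by (auto simp: symdiff_def Y'_def)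
    have "card Y' = r" using x \<open>y \<in> Y\<close> fin less.prems(3)
      by (simp add: Y'_def card_Diff_singleton card_gt_0_iff) (metis Suc_pred card_gt_0_iff empty_iff)
    moreover have "X - Y' \<subset> X - Y"
      using x y(1) \<open>y \<in> Y\<close> by (auto simp: symdiff_def Y'_def)
    then have "card (X - Y') < card (X - Y)" using fin by (intro psubset_card_mono) auto
    ultimately show ?thesis
      using less.hyps[of Y'] y(2) eq xv less.prems(2) by (auto simp: Y'_def)
  qed
qed

section \<open>Membership after loop complementations and twists\<close>

text \<open>The sets counted for \<open>insert v X\<close> split into those containing
  \<open>v\<close>, counted for \<open>Y\<close> and \<open>X\<close>, and those avoiding
  \<open>v\<close>, counted for \<open>Y - {v}\<close> and \<open>X\<close>; the parities add. This
  recursion permits induction on \<open>X\<close>.\<close>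

lemma mem_loop_compl_insert:
  assumes N: "set_system N" and v: "v \<in> Y" "v \<notin> X" and Y: "Y \<subseteq> ground N"
  shows "Y \<in> members (loop_compl N (insert v X)) \<longleftrightarrow>
    (Y \<in> members (loop_compl N X)) \<noteq> (Y - {v} \<in> members (loop_compl N X))"
proof -
  let ?A = "{Z \<in> members N. Y - X \<subseteq> Z \<and> Z \<subseteq> Y}"
  let ?B = "{Z \<in> members N. (Y - {v}) - X \<subseteq> Z \<and> Z \<subseteq> Y - {v}}"
  have "finite (members N)" using N unfolding set_system_def by (auto intro: finite_subset)
  then have "finite ?A" "finite ?B" by auto
  moreover have "{Z \<in> members N. Y - insert v X \<subseteq> Z \<and> Z \<subseteq> Y} = ?A \<union> ?B" "?A \<inter> ?B = {}"
    using v by auto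
  ultimately have "card {Z \<in> members N. Y - insert v X \<subseteq> Z \<and> Z \<subseteq> Y} = card ?A + card ?B"
    by (simp add: card_Un_disjoint)
  moreover have "Y - {v} \<subseteq> ground N" using Y by auto
  ultimately show ?thesis using Y by (simp add: loop_compl_def)
qed

lemma mem_loop_compl_empty:
  assumes "set_system N"
  shows "Y \<in> members (loop_compl N {}) \<longleftrightarrow> Y \<in> members N"
proof -
  have "{Z \<in> members N. Y - {} \<subseteq> Z \<and> Z \<subseteq> Y} = (if Y \<in> members N then {Y} else {})" by auto
  then show ?thesis using assms by (auto simp: loop_compl_def set_system_def)
qed

lemma mem_loop_compl_singleton:
  assumes N: "set_system N" and v: "v \<in> ground N" "v \<notin> Y"
  shows "Y \<in> members (loop_compl N {v}) \<longleftrightarrow> Y \<in> members N"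
    and "insert v Y \<in> members (loop_compl N {v}) \<longleftrightarrow> (insert v Y \<in> members N) \<noteq> (Y \<in> members N)"
proof -
  have "Y - {v} = Y" using v by auto
  then show "Y \<in> members (loop_compl N {v}) \<longleftrightarrow> Y \<in> members N"
    using mem_loop_compl_empty[OF N, of Y] by (simp add: loop_compl_def)
  have *: "members N \<subseteq> Pow (ground N)" using N by (simp add: set_system_def)
  show "insert v Y \<in> members (loop_compl N {v}) \<longleftrightarrow> (insert v Y \<in> members N) \<noteq> (Y \<in> members N)"
  proof (cases "Y \<subseteq> ground N")
    case True
    then show ?thesis using mem_loop_compl_insert[OF N, of v "insert v Y" "{}"] v
      by (simp add: mem_loop_compl_empty[OF N])
  next
    case False
    then show ?thesis using * by (auto simp: loop_compl_def)
  qed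
qed

lemma mem_twist_iff: "Y \<in> members (twist N X) \<longleftrightarrow> symdiff Y X \<in> members N"
proof -
  have "symdiff (symdiff Z X) X = Z" for Z :: "'a set" by (auto simp: symdiff_def)
  then show ?thesis by (simp add: twist_def) metis
qed

lemma mem_twist_singleton:
  assumes "v \<notin> Y"
  shows "Y \<in> members (twist N {v}) \<longleftrightarrow> insert v Y \<in> members N"
    and "insert v Y \<in> members (twist N {v}) \<longleftrightarrow> Y \<in> members N"
proof -
  have "symdiff Y {v} = insert v Y" "symdiff (insert v Y) {v} = Y"
    using assms by (auto simp: symdiff_def)
  then show "Y \<in> members (twist N {v}) \<longleftrightarrow> insert v Y \<in> members N"
    and "insert v Y \<in> members (twist N {v}) \<longleftrightarrow> Y \<in> members N"
    by (simp_all add: mem_twist_iff)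
qed

section \<open>The trichotomy at a single element\<close>

text \<open>Members through \<open>v\<close> are recorded with \<open>v\<close> removed, which
  lowers their size by one; hence the strict inequality for them.\<close>

lemma not_coloop_max_iff':
  assumes N: "delta_matroid N" and v: "v \<in> ground N"
  shows "\<not> coloop (max_members N) v \<longleftrightarrow>
    (\<exists>Y. v \<notin> Y \<and> Y \<in> members N \<and> (\<forall>Z. v \<notin> Z \<longrightarrow>
       (Z \<in> members N \<longrightarrow> card Z \<le> card Y) \<and> (insert v Z \<in> members N \<longrightarrow> card Z < card Y)))"
proof -
  have "(\<forall>Z \<in> members N. card Z \<le> card Y) \<longleftrightarrow> (\<forall>Z. v \<notin> Z \<longrightarrow>
       (Z \<in> members N \<longrightarrow> card Z \<le> card Y) \<and> (insert v Z \<in> members N \<longrightarrow> card Z < card Y))"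
    (is "?L \<longleftrightarrow> ?R") for Y
  proof
    assume L: ?L
    show ?R
    proof (intro allI impI conjI)
      fix Z assume Z: "v \<notin> Z" "insert v Z \<in> members N"
      then have "finite Z" using delta_matroid_finite_members(2)[OF N, of "insert v Z"] by auto
      then show "card Z < card Y" using L Z by fastforce
    qed (use L in auto)
  next
    assume R: ?R
    show ?L
    proof
      fix Z assume Z: "Z \<in> members N"
      then have "finite Z" using delta_matroid_finite_members(2)[OF N] by auto
      show "card Z \<le> card Y"
      proof (cases "v \<in> Z")
        case True
        then have "insert v (Z - {v}) = Z" by auto
        then have "card (Z - {v}) < card Y" using R Z by auto
        then show ?thesis using True \<open>finite Z\<close> by (simp add: card_Diff_singleton)
      qed (use R Z in auto)
    qed
  qed
  then show ?thesis using not_coloop_max_iff[OF N v] by auto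
qed

text \<open>\<open>N\<close>, its twist and its loop complement carry the pairs \<open>f, g\<close>,
  then \<open>g, f\<close>, then \<open>f, h\<close>, where \<open>h\<close> is the symmetric
  difference. In each, \<open>v\<close> is not a coloop of the maximal members iff the first family
  reaches strictly higher than the second. The cases record which of \<open>f\<close> and
  \<open>g\<close> reach the common top level \<open>m\<close>.\<close>

lemma coloop_trichotomy:
  assumes N: "delta_matroid N" and N1: "delta_matroid (twist N {v})"
    and N2: "delta_matroid (loop_compl N {v})" and v: "v \<in> ground N"
  defines "p \<equiv> \<not> coloop (max_members (loop_compl N {v})) v"
    and "q \<equiv> \<not> coloop (max_members (twist N {v})) v"
    and "r \<equiv> \<not> coloop (max_members N) v"
  shows "p \<and> \<not> q \<and> \<not> r \<or> \<not> p \<and> q \<and> \<not> r \<or> \<not> p \<and> \<not> q \<and> r"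
proof -
  have ss: "set_system N" using N by (simp add: delta_matroid_def)
  define f where "f Y \<longleftrightarrow> v \<notin> Y \<and> Y \<in> members N" for Y
  define g where "g Y \<longleftrightarrow> v \<notin> Y \<and> insert v Y \<in> members N" for Y
  have gr: "v \<in> ground (twist N {v})" "v \<in> ground (loop_compl N {v})"
    using v by (simp_all add: twist_def loop_compl_def)
  have r: "r \<longleftrightarrow> (\<exists>Y. f Y \<and> (\<forall>Z. (f Z \<longrightarrow> card Z \<le> card Y) \<and> (g Z \<longrightarrow> card Z < card Y)))"
    unfolding r_def not_coloop_max_iff'[OF N v] f_def g_def by blast
  have q: "q \<longleftrightarrow> (\<exists>Y. g Y \<and> (\<forall>Z. (g Z \<longrightarrow> card Z \<le> card Y) \<and> (f Z \<longrightarrow> card Z < card Y)))"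
    unfolding q_def not_coloop_max_iff'[OF N1 gr(1)] f_def g_def
    using mem_twist_singleton[of v _ N] by blast
  have p: "p \<longleftrightarrow> (\<exists>Y. f Y \<and> (\<forall>Z. (f Z \<longrightarrow> card Z \<le> card Y) \<and> (f Z \<noteq> g Z \<longrightarrow> card Z < card Y)))"
    unfolding p_def not_coloop_max_iff'[OF N2 gr(2)] f_def g_def
    using mem_loop_compl_singleton[OF ss v] by blast
  \<comment> \<open>Sizes are taken with \<open>v\<close> removed, so members of \<open>N\<close>
    may have \<open>m + 1\<close> elements, as \<open>delta_matroid_insert_top\<close>
    allows.\<close>
  define m where "m = Max (card ` {Z. f Z \<or> g Z})"
  have "{Z. f Z \<or> g Z} \<subseteq> Pow (ground N)"
    using ss by (auto simp: f_def g_def set_system_def)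
  then have fin: "finite {Z. f Z \<or> g Z}" using ss
    by (meson finite_Pow_iff finite_subset set_system_def)
  obtain Y where "Y \<in> members N" using N by (auto simp: delta_matroid_def proper_def)
  then have "f Y \<or> g (Y - {v})" by (auto simp: f_def g_def insert_absorb)
  then have "m \<in> card ` {Z. f Z \<or> g Z}" unfolding m_def using fin by (intro Max_in) auto
  then have ex: "\<exists>Z. (f Z \<or> g Z) \<and> card Z = m" by auto
  have le: "card Z \<le> m" if "f Z \<or> g Z" for Z
    unfolding m_def using fin that by (intro Max_ge) auto
  have top: "card Z \<le> Suc m" if Z: "Z \<in> members N" for Z
    using le[of Z] le[of "Z - {v}"] Z delta_matroid_finite_members(2)[OF N Z]
    by (cases "v \<in> Z") (auto simp: f_def g_def insert_absorb card_Diff_singleton)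
  have top': "card Z \<le> Suc m" if Z: "Z \<in> members (twist N {v})" for Z
  proof (cases "v \<in> Z")
    case True
    then have "f (Z - {v})" using Z mem_twist_singleton(2)[of v "Z - {v}" N]
      by (auto simp: f_def insert_absorb)
    then show ?thesis using le[of "Z - {v}"] True delta_matroid_finite_members(2)[OF N1 Z]
      by (auto simp: card_Diff_singleton)
  next
    case False
    then have "g Z" using Z mem_twist_singleton(1)[of v Z N] by (auto simp: g_def)
    then show ?thesis using le[of Z] by auto
  qed
  have fg: "g X" if "f X" "card X = m" "g Y" "card Y = m" for X Y
    using delta_matroid_insert_top[OF N, of X v m Y] that le top by (auto simp: f_def g_def)
  \<comment> \<open>The twist interchanges \<open>f\<close> and \<open>g\<close>, so the same
    exchange argument gives the reverse inclusion of the top levels.\<close>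
  have gf: "f X" if "g X" "card X = m" "f Y" "card Y = m" for X Y
    using delta_matroid_insert_top[OF N1, of X v m Y] that le top'
    by (auto simp: f_def g_def mem_twist_singleton)
  consider "\<exists>X. f X \<and> card X = m" "\<not> (\<exists>X. g X \<and> card X = m)"
    | "\<not> (\<exists>X. f X \<and> card X = m)" "\<exists>X. g X \<and> card X = m"
    | "\<exists>X. f X \<and> card X = m" "\<exists>X. g X \<and> card X = m"
    using ex by blast
  then show ?thesis
  proof cases
    case 1
    then have r by (unfold r) (metis le nless_le)
    moreover have "\<not> q" by (unfold q) (metis 1 le nless_le not_le)
    moreover have "\<not> p" by (unfold p) (metis 1 le nless_le not_le)
    ultimately show ?thesis by blast
  next
    case 2
    then have q by (unfold q) (metis le nless_le)
    moreover have "\<not> r" by (unfold r) (metis 2 le nless_le not_le)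
    moreover have "\<not> p" by (unfold p) (metis 2 le nless_le not_le)
    ultimately show ?thesis by blast
  next
    case 3
    then have eq: "f Z \<longleftrightarrow> g Z" if "card Z = m" for Z using fg gf that by blast
    have p by (unfold p) (metis 3(1) eq le nless_le)
    moreover have "\<not> r" by (unfold r) (metis 3 le nless_le not_le)
    moreover have "\<not> q" by (unfold q) (metis 3 le nless_le not_le)
    ultimately show ?thesis by blast
  qed
qed

subsection \<open>Binary vectors and the symplectic plane\<close>

declare add_bit_eq_xor [simp del] mult_bit_eq_and [simp del]

lemma bit_add_self [simp]: "(x :: bit) + x = 0"
  by (cases x) simp_all

lemma bit_add_eq_0_iff: "(x :: bit) + y = 0 \<longleftrightarrow> x = y"
  by (cases x; cases y) simp_all

text \<open>Over GF(2) closure under addition makes \<open>S\<close> a subspace, and a vector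
  outside it is detected by a functional \<open>w\<close> vanishing on it. The induction is Gaussian
  elimination, one coordinate at a time.\<close>

lemma bit_separation:
  fixes S :: "('i \<Rightarrow> bit) set"
  assumes "finite I" and "0 \<in> S" and "\<And>f g. f \<in> S \<Longrightarrow> g \<in> S \<Longrightarrow> f + g \<in> S"
    and "\<And>f i. f \<in> S \<Longrightarrow> i \<notin> I \<Longrightarrow> f i = 0" and "\<And>i. i \<notin> I \<Longrightarrow> e i = 0" and "e \<notin> S"
  shows "\<exists>w. (\<forall>i. i \<notin> I \<longrightarrow> w i = 0) \<and> (\<forall>f \<in> S. (\<Sum>i\<in>I. w i * f i) = 0) \<and> (\<Sum>i\<in>I. w i * e i) = 1"
  using assms
proof (induction I arbitrary: S e rule: finite_induct)
  case empty
  then have "e = 0" by (simp add: fun_eq_iff)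
  then show ?case using empty by simp
next
  case (insert a I)
  have S0: "0 \<in> S" and Sadd: "\<And>f g. f \<in> S \<Longrightarrow> g \<in> S \<Longrightarrow> f + g \<in> S"
    by (fact insert.prems)+
  note Ssupp = insert.prems(3) and esupp = insert.prems(4) and eS = insert.prems(5)
  let ?T = "{f \<in> S. f a = 0}"
  have T: "0 \<in> ?T" "\<And>f g. f \<in> ?T \<Longrightarrow> g \<in> ?T \<Longrightarrow> f + g \<in> ?T"
    "\<And>f i. f \<in> ?T \<Longrightarrow> i \<notin> I \<Longrightarrow> f i = 0"
    subgoal using S0 by simp
    subgoal using Sadd by simp
    subgoal for f i using Ssupp[of f i] by (cases "i = a") auto
    done
  show ?case
  proof (cases "\<exists>s \<in> S. s a = 1")
    case True
    then obtain s where s: "s \<in> S" "s a = 1" by blast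
    \<comment> \<open>Reduces \<open>e\<close> modulo the pivot vector \<open>s\<close>, so that
      coordinate \<open>a\<close> disappears.\<close>
    define e' where "e' = (if e a = 1 then e + s else e)"
    have e'0: "e' a = 0" using s by (auto simp: e'_def)
    have e'supp: "e' i = 0" if "i \<notin> I" for i
      using that e'0 esupp Ssupp[OF s(1)] by (cases "i = a") (auto simp: e'_def)
    have "e' \<notin> S"
    proof
      assume "e' \<in> S"
      then have "e' \<in> S" "e' + s \<in> S" using s Sadd by auto
      moreover have "e = e' \<or> e = e' + s" by (auto simp: e'_def fun_eq_iff add.assoc)
      ultimately show False using eS by auto
    qed
    then have e'T: "e' \<notin> ?T" by blast
    have "\<exists>w. (\<forall>i. i \<notin> I \<longrightarrow> w i = 0) \<and> (\<forall>f \<in> ?T. (\<Sum>i\<in>I. w i * f i) = 0) \<and> (\<Sum>i\<in>I. w i * e' i) = 1"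
      by (rule insert.IH[of ?T e']) (fact T e'supp e'T)+
    then obtain w where
      w: "\<And>i. i \<notin> I \<Longrightarrow> w i = 0" "\<And>f. f \<in> ?T \<Longrightarrow> (\<Sum>i\<in>I. w i * f i) = 0" "(\<Sum>i\<in>I. w i * e' i) = 1"
      by blast
    \<comment> \<open>The weight at \<open>a\<close> is the one for which the extended functional
      annihilates \<open>s\<close>.\<close>
    define w' where "w' = w(a := \<Sum>i\<in>I. w i * s i)"
    have sum: "(\<Sum>i\<in>insert a I. w' i * f i) = (\<Sum>i\<in>I. w i * s i) * f a + (\<Sum>i\<in>I. w i * f i)" for f
    proof -
      have "(\<Sum>i\<in>I. w' i * f i) = (\<Sum>i\<in>I. w i * f i)"
        using insert.hyps by (intro sum.cong) (auto simp: w'_def)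
      then show ?thesis using insert.hyps by (simp add: w'_def)
    qed
    have "(\<Sum>i\<in>insert a I. w' i * f i) = 0" if f: "f \<in> S" for f
    proof (cases "f a = 0")
      case True
      then show ?thesis using w(2)[of f] f by (simp add: sum)
    next
      case False
      then have "f + s \<in> ?T" using f s Sadd by simp
      from w(2)[OF this] show ?thesis using False
        by (simp add: sum distrib_left sum.distrib add.commute)
    qed
    moreover have "(\<Sum>i\<in>insert a I. w' i * e i) = 1"
      using w(3) s(2)
      by (cases "e a = 0") (simp_all add: sum e'_def distrib_left sum.distrib add.commute)
    moreover have "w' i = 0" if "i \<notin> insert a I" for i using w(1) that by (simp add: w'_def)
    ultimately show ?thesis by blast
  next
    case False
    then have TS: "?T = S" by auto
    show ?thesis
    proof (cases "e a = 0")
      case True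
      then have esupp': "e i = 0" if "i \<notin> I" for i using that esupp by (cases "i = a") auto
      have eT: "e \<notin> ?T" using eS by blast
      have "\<exists>w. (\<forall>i. i \<notin> I \<longrightarrow> w i = 0) \<and> (\<forall>f \<in> ?T. (\<Sum>i\<in>I. w i * f i) = 0) \<and> (\<Sum>i\<in>I. w i * e i) = 1"
        by (rule insert.IH[of ?T e]) (fact T esupp' eT)+
      then obtain w where
        w: "\<And>i. i \<notin> I \<Longrightarrow> w i = 0" "\<And>f. f \<in> S \<Longrightarrow> (\<Sum>i\<in>I. w i * f i) = 0" "(\<Sum>i\<in>I. w i * e i) = 1"
        unfolding TS by blast
      then show ?thesis using True insert.hyps by (intro exI[of _ w]) auto
    next
      \<comment> \<open>All of \<open>S\<close> vanishes at \<open>a\<close> but \<open>e\<close>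
        does not, so evaluation at \<open>a\<close> separates.\<close>
      case ea: False
      have "(\<Sum>i\<in>insert a I. of_bool (i = a) * f i) = f a" for f :: "'i \<Rightarrow> bit"
        using insert.hyps by (simp add: sum.neutral)
      then show ?thesis using ea False by (intro exI[of _ "\<lambda>i. of_bool (i = a)"]) auto
    qed
  qed
qed

section \<open>The symplectic plane over GF(2)\<close>

text \<open>This is the 2 by 2 determinant, whose sign disappears in characteristic 2.\<close>

definition plane_form :: "bit \<times> bit \<Rightarrow> bit \<times> bit \<Rightarrow> bit" where
  "plane_form p q = fst p * snd q + snd p * fst q"

lemma plane_form_zero [simp]: "plane_form 0 q = 0" "plane_form p 0 = 0"
  by (simp_all add: plane_form_def)

lemma plane_form_eq_0_iff: "plane_form p q = 0 \<longleftrightarrow> p = 0 \<or> q = 0 \<or> p = q"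
  unfolding plane_form_def prod_eq_iff fst_zero snd_zero
  by (cases "fst p"; cases "snd p"; cases "fst q"; cases "snd q") simp_all

lemma plane_add_self [simp]: "(p :: bit \<times> bit) + p = 0"
  by (simp add: prod_eq_iff)

lemma plane_third:
  fixes p q s :: "bit \<times> bit"
  assumes "p \<noteq> 0" "q \<noteq> 0" "p \<noteq> q"
  shows "s = 0 \<or> s = p \<or> s = q \<or> s = p + q" and "p + q \<noteq> 0" and "p + q \<noteq> p" and "p + q \<noteq> q"
proof -
  show "s = 0 \<or> s = p \<or> s = q \<or> s = p + q"
    using assms unfolding prod_eq_iff fst_add snd_add fst_zero snd_zero
    by (cases "fst p"; cases "snd p"; cases "fst q"; cases "snd q"; cases "fst s"; cases "snd s") simp_all
  show "p + q \<noteq> 0" using assms(3) by (auto simp: prod_eq_iff bit_add_eq_0_iff)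
qed (use assms in auto)

text \<open>The two coordinates at each \<open>v\<close> are spread over the index set
  \<open>V \<times> UNIV\<close>, which reduces the claim to \<open>bit_separation\<close>.\<close>

lemma symplectic_separation:
  fixes S :: "('a \<Rightarrow> bit \<times> bit) set"
  assumes V: "finite V" and S0: "0 \<in> S" and Sadd: "\<And>f g. f \<in> S \<Longrightarrow> g \<in> S \<Longrightarrow> f + g \<in> S"
    and Ssupp: "\<And>f v. f \<in> S \<Longrightarrow> v \<notin> V \<Longrightarrow> f v = 0" and esupp: "\<And>v. v \<notin> V \<Longrightarrow> e v = 0"
    and eS: "e \<notin> S"
  shows "\<exists>q. (\<forall>v. v \<notin> V \<longrightarrow> q v = 0) \<and> (\<forall>p \<in> S. (\<Sum>v\<in>V. plane_form (q v) (p v)) = 0) \<and>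
    (\<Sum>v\<in>V. plane_form (q v) (e v)) = 1"
proof -
  define enc :: "('a \<Rightarrow> bit \<times> bit) \<Rightarrow> 'a \<times> bool \<Rightarrow> bit"
    where "enc p = (\<lambda>(v, b). if b then snd (p v) else fst (p v))" for p
  have add: "enc p + enc q = enc (p + q)" for p q
    by (auto simp: enc_def fun_eq_iff)
  have inj: "p = q" if "enc p = enc q" for p q
  proof
    fix v
    show "p v = q v" using fun_cong[OF that, of "(v, True)"] fun_cong[OF that, of "(v, False)"]
      by (simp add: enc_def prod_eq_iff)
  qed
  have "\<exists>w. (\<forall>i. i \<notin> V \<times> UNIV \<longrightarrow> w i = 0) \<and> (\<forall>f \<in> enc ` S. (\<Sum>i\<in>V \<times> UNIV. w i * f i) = 0)
      \<and> (\<Sum>i\<in>V \<times> UNIV. w i * enc e i) = 1"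
  proof (rule bit_separation)
    have "enc 0 = 0" by (auto simp: enc_def fun_eq_iff)
    then show "0 \<in> enc ` S" using S0 by (metis imageI)
    show "enc e \<notin> enc ` S" using eS inj by auto
    show "f i = 0" if fi: "f \<in> enc ` S" "i \<notin> V \<times> UNIV" for f i
    proof -
      obtain p where "p \<in> S" "f = enc p" using fi by auto
      then show ?thesis using fi(2) Ssupp[of p "fst i"] by (cases i) (auto simp: enc_def)
    qed
    show "enc e i = 0" if "i \<notin> V \<times> UNIV" for i
      using that esupp by (cases i) (auto simp: enc_def)
  qed (use V Sadd in \<open>auto simp: add\<close>)
  then obtain w where w: "\<And>i. i \<notin> V \<times> UNIV \<Longrightarrow> w i = 0"
    "\<And>p. p \<in> S \<Longrightarrow> (\<Sum>i\<in>V \<times> UNIV. w i * enc p i) = 0" "(\<Sum>i\<in>V \<times> UNIV. w i * enc e i) = 1"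
    by blast
  \<comment> \<open>The coordinates are swapped because \<open>plane_form\<close> pairs first
    coordinates with second ones.\<close>
  define q where "q = (\<lambda>v. (w (v, True), w (v, False)))"
  have sum: "(\<Sum>v\<in>V. plane_form (q v) (p v)) = (\<Sum>i\<in>V \<times> UNIV. w i * enc p i)" for p
  proof -
    have "(\<Sum>i\<in>V \<times> UNIV. w i * enc p i) = (\<Sum>v\<in>V. \<Sum>b\<in>UNIV. w (v, b) * enc p (v, b))"
      by (simp add: sum.cartesian_product)
    then show ?thesis by (simp add: UNIV_bool plane_form_def q_def enc_def add.commute)
  qed
  have "\<forall>v. v \<notin> V \<longrightarrow> q v = 0" using w(1) by (simp add: q_def zero_prod_def)
  then show ?thesis using w(2,3) by (intro exI[of _ q]) (simp add: sum)
qed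

subsection \<open>Isotropic systems\<close>

text \<open>\<open>isotropic\<close> and \<open>maximal\<close> together say that \<open>L\<close>
  is its own orthogonal complement. This expresses being Lagrangian without a dimension
  count.\<close>

locale isotropic_system =
  fixes V :: "'a set" and L :: "('a \<Rightarrow> bit \<times> bit) set"
  assumes finite_ground: "finite V"
    and supp: "p \<in> L \<Longrightarrow> v \<notin> V \<Longrightarrow> p v = 0"
    and zero: "0 \<in> L"
    and add: "p \<in> L \<Longrightarrow> q \<in> L \<Longrightarrow> p + q \<in> L"
    and isotropic: "p \<in> L \<Longrightarrow> q \<in> L \<Longrightarrow> (\<Sum>v\<in>V. plane_form (p v) (q v)) = 0"
    and maximal: "(\<And>v. v \<notin> V \<Longrightarrow> p v = 0) \<Longrightarrow>
      (\<And>q. q \<in> L \<Longrightarrow> (\<Sum>v\<in>V. plane_form (p v) (q v)) = 0) \<Longrightarrow> p \<in> L"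
begin

text \<open>\<open>J\<close> spans a line at each element, and \<open>L\<close> must meet the
  product of these lines trivially. A value \<open>J z = 0\<close> is allowed and forces vectors to
  vanish at \<open>z\<close>.\<close>

definition complementary :: "('a \<Rightarrow> bit \<times> bit) \<Rightarrow> bool" where
  "complementary J \<longleftrightarrow> (\<forall>p \<in> L. (\<forall>v \<in> V. p v = 0 \<or> p v = J v) \<longrightarrow> p = 0)"

lemma complementaryD:
  "complementary J \<Longrightarrow> p \<in> L \<Longrightarrow> (\<And>v. v \<in> V \<Longrightarrow> p v = 0 \<or> p v = J v) \<Longrightarrow> p = 0"
  by (simp add: complementary_def)

lemma complementary_cong:
  "(\<And>v. v \<in> V \<Longrightarrow> J v = K v) \<Longrightarrow> complementary J \<longleftrightarrow> complementary K"
  unfolding complementary_def by (metis (no_types))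

lemma isotropic_at:
  assumes "p \<in> L" "q \<in> L" "z \<in> V" and "\<And>v. v \<in> V \<Longrightarrow> v \<noteq> z \<Longrightarrow> plane_form (p v) (q v) = 0"
  shows "plane_form (p z) (q z) = 0"
proof -
  have "(\<Sum>v\<in>V. plane_form (p v) (q v)) = plane_form (p z) (q z) + (\<Sum>v\<in>V - {z}. plane_form (p v) (q v))"
    using assms(3) finite_ground by (rule sum.remove[rotated])
  also have "(\<Sum>v\<in>V - {z}. plane_form (p v) (q v)) = 0"
    using assms(4) by (intro sum.neutral) auto
  finally show ?thesis using isotropic[OF assms(1,2)] by simp
qed

text \<open>Stands in for a dimension count. With \<open>T\<close> the product of the lines of
  \<open>J\<close> away from \<open>z\<close>, either a vector \<open>e\<close> living at
  \<open>z\<close> lies in \<open>L + T\<close>, which exhibits \<open>F\<close>, or a vector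
  \<open>q\<close> separates \<open>e\<close> from \<open>L + T\<close>. In the second case
  \<open>q\<close> is orthogonal to \<open>L\<close>, hence lies in \<open>L\<close>, and can serve
  as \<open>F\<close>.\<close>

lemma ex_vector_off:
  assumes z: "z \<in> V" and J: "\<And>v. v \<in> V \<Longrightarrow> J v \<noteq> 0"
  obtains F where "F \<in> L" "F z \<noteq> 0" "\<And>v. v \<in> V \<Longrightarrow> v \<noteq> z \<Longrightarrow> F v = 0 \<or> F v = J v"
proof -
  define T where "T = {j. (\<forall>v. v \<notin> V \<longrightarrow> j v = 0) \<and> j z = 0 \<and> (\<forall>v \<in> V. j v = 0 \<or> j v = J v)}"
  define S where "S = {l + j | l j. l \<in> L \<and> j \<in> T}"
  define e where "e = (\<lambda>v. if v = z then (1, 0) else (0 :: bit \<times> bit))"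
  have T0: "0 \<in> T" by (simp add: T_def)
  have Tadd: "j + k \<in> T" if "j \<in> T" "k \<in> T" for j k
  proof -
    have "(j + k) v = 0 \<or> (j + k) v = J v" if "v \<in> V" for v
    proof -
      have "j v = 0 \<or> j v = J v" "k v = 0 \<or> k v = J v"
        using that \<open>j \<in> T\<close> \<open>k \<in> T\<close> by (auto simp: T_def)
      then show ?thesis by auto
    qed
    then show ?thesis using \<open>j \<in> T\<close> \<open>k \<in> T\<close> by (simp add: T_def)
  qed
  have LS: "L \<subseteq> S" "T \<subseteq> S"
  proof -
    have "l + 0 \<in> S" if "l \<in> L" for l using that T0 unfolding S_def by blast
    then show "L \<subseteq> S" by auto
    have "0 + j \<in> S" if "j \<in> T" for j using that zero unfolding S_def by blast
    then show "T \<subseteq> S" by auto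
  qed
  show ?thesis
  proof (cases "e \<in> S")
    case True
    then obtain l j where lj: "l \<in> L" "j \<in> T" "e = l + j" by (auto simp: S_def)
    have l: "l v = e v + j v" for v using lj(3) by (simp add: add.assoc)
    show ?thesis
    proof (rule that[OF lj(1)])
      show "l z \<noteq> 0" using lj(2) by (simp add: l e_def T_def zero_prod_def)
      show "l v = 0 \<or> l v = J v" if "v \<in> V" "v \<noteq> z" for v
        using lj(2) that by (simp add: l e_def T_def)
    qed
  next
    case False
    have 1: "0 \<in> S" using LS zero by auto
    have 2: "f + g \<in> S" if fg: "f \<in> S" "g \<in> S" for f g
    proof -
      obtain l j l' j' where "l \<in> L" "j \<in> T" "l' \<in> L" "j' \<in> T" "f = l + j" "g = l' + j'"
        using fg by (auto simp: S_def)
      moreover have "l + j + (l' + j') = (l + l') + (j + j')" by (simp add: algebra_simps)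
      ultimately show ?thesis using add Tadd unfolding S_def by blast
    qed
    have 3: "f v = 0" if "f \<in> S" "v \<notin> V" for f v
      using that supp by (auto simp: S_def T_def)
    have 4: "e v = 0" if "v \<notin> V" for v using that z by (auto simp: e_def)
    have "\<exists>q. (\<forall>v. v \<notin> V \<longrightarrow> q v = 0) \<and> (\<forall>p \<in> S. (\<Sum>v\<in>V. plane_form (q v) (p v)) = 0) \<and>
        (\<Sum>v\<in>V. plane_form (q v) (e v)) = 1"
      by (rule symplectic_separation) (fact finite_ground 1 2 3 4 False)+
    then obtain q where q: "\<And>v. v \<notin> V \<Longrightarrow> q v = 0"
      "\<And>p. p \<in> S \<Longrightarrow> (\<Sum>v\<in>V. plane_form (q v) (p v)) = 0" "(\<Sum>v\<in>V. plane_form (q v) (e v)) = 1"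
      by blast
    have single: "(\<Sum>v\<in>V. plane_form (q v) (if v = u then k else 0)) = plane_form (q u) k" if "u \<in> V" for u k
    proof -
      have "(\<Sum>v\<in>V. plane_form (q v) (if v = u then k else 0)) = (\<Sum>v\<in>V. if v = u then plane_form (q v) k else 0)"
        by (intro sum.cong) auto
      then show ?thesis using finite_ground that by simp
    qed
    show ?thesis
    proof (rule that)
      show "q \<in> L" using q LS by (intro maximal) auto
      show "q z \<noteq> 0" using q(3) single[OF z] by (auto simp: e_def)
      \<comment> \<open>Orthogonality to \<open>T\<close> is tested on the vector with the single
        nonzero value \<open>J v\<close>.\<close>
      show "q v = 0 \<or> q v = J v" if v: "v \<in> V" "v \<noteq> z" for v
      proof -
        have "(\<lambda>u. if u = v then J v else 0) \<in> T" using v by (auto simp: T_def)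
        then have "plane_form (q v) (J v) = 0" using q(2) LS single[OF v(1)] by (metis (no_types) subsetD)
        then show ?thesis using J[OF v(1)] by (auto simp: plane_form_eq_0_iff)
      qed
    qed
  qed
qed

text \<open>\<open>F z\<close> is the only forbidden value at \<open>z\<close>. A vector
  \<open>H\<close> of \<open>L\<close> fitting \<open>J(z := t)\<close> is orthogonal to
  \<open>F\<close> away from \<open>z\<close>, hence also at \<open>z\<close>, so for
  \<open>t \<noteq> F z\<close> it vanishes there.\<close>

lemma complementary_update:
  assumes z: "z \<in> V" and F: "F \<in> L" "F z \<noteq> 0" "\<And>v. v \<in> V \<Longrightarrow> v \<noteq> z \<Longrightarrow> F v = 0 \<or> F v = J v"
    and J: "complementary (J(z := 0))" and t: "t \<noteq> 0"
  shows "complementary (J(z := t)) \<longleftrightarrow> t \<noteq> F z"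
proof
  assume c: "complementary (J(z := t))"
  show "t \<noteq> F z"
  proof
    assume "t = F z"
    then have "F = 0" using F by (intro complementaryD[OF c]) (metis fun_upd_apply)+
    then show False using F(2) by simp
  qed
next
  assume tF: "t \<noteq> F z"
  show "complementary (J(z := t))"
    unfolding complementary_def
  proof (intro ballI impI)
    fix H assume H: "H \<in> L" "\<forall>v\<in>V. H v = 0 \<or> H v = (J(z := t)) v"
    have "plane_form (H v) (F v) = 0" if "v \<in> V" "v \<noteq> z" for v
      using H(2) F(3)[OF that] that by (auto simp: plane_form_eq_0_iff)
    from isotropic_at[OF H(1) F(1) z this] have "H z = 0"
      using H(2) z F(2) tF by (auto simp: plane_form_eq_0_iff)
    then show "H = 0" using H by (intro complementaryD[OF J]) auto
  qed
qed

text \<open>With the other coordinates fixed, either none or exactly two of the three lines at \<open>z\<close> give a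
  complement of \<open>L\<close>. This is the parity underlying loop complementation.\<close>

lemma complementary_parity:
  assumes z: "z \<in> V" and J: "\<And>v. v \<in> V \<Longrightarrow> J v \<noteq> 0"
    and st: "s \<noteq> 0" "t \<noteq> 0" "s \<noteq> t"
  shows "complementary (J(z := s + t)) \<longleftrightarrow> complementary (J(z := s)) \<noteq> complementary (J(z := t))"
proof (cases "complementary (J(z := 0))")
  case True
  obtain F where F: "F \<in> L" "F z \<noteq> 0" "\<And>v. v \<in> V \<Longrightarrow> v \<noteq> z \<Longrightarrow> F v = 0 \<or> F v = J v"
    using ex_vector_off[of z J, OF z J] by blast
  note upd = complementary_update[OF z F True]
  \<comment> \<open>The nonzero vectors of the plane are \<open>s\<close>, \<open>t\<close> and
    \<open>s + t\<close>; exactly one of them is \<open>F z\<close>, so exactly two are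
    admissible.\<close>
  show ?thesis
    using plane_third(1)[OF st, of "F z"] plane_third(2-4)[OF st] F(2) st by (auto simp: upd)
next
  case False
  have "\<not> complementary (J(z := k))" for k
  proof
    assume "complementary (J(z := k))"
    then have "complementary (J(z := 0))" unfolding complementary_def by fastforce
    then show False using False by simp
  qed
  then show ?thesis by simp
qed

text \<open>\<open>F\<close> spans the intersection of \<open>L\<close> with the space obtained from \<open>J\<close> by freeing the
  coordinate \<open>z\<close>.\<close>

lemma complementary_pivot:
  assumes z: "z \<in> V" "w \<in> V" "w \<noteq> z" and J: "complementary J"
    and F: "F \<in> L" "F z \<noteq> 0" "\<And>v. v \<in> V \<Longrightarrow> v \<noteq> z \<Longrightarrow> F v = 0 \<or> F v = J v"
    and Fw: "F w \<noteq> 0" and s: "s \<noteq> J w"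
  shows "complementary (J(z := F z, w := s))"
  unfolding complementary_def
proof (intro ballI impI)
  fix H assume H: "H \<in> L" "\<forall>v\<in>V. H v = 0 \<or> H v = (J(z := F z, w := s)) v"
  \<comment> \<open>Away from \<open>w\<close> the values of \<open>H\<close> and \<open>F\<close>
    lie on common lines, so isotropy is tested at \<open>w\<close> alone, where
    \<open>F w = J w\<close> differs from \<open>s\<close>.\<close>
  have "plane_form (H v) (F v) = 0" if "v \<in> V" "v \<noteq> w" for v
    using H(2) F(3)[OF that(1)] that z by (cases "v = z") (auto simp: plane_form_eq_0_iff)
  from isotropic_at[OF H(1) F(1) z(2) this] have Hw: "H w = 0"
    using H(2) z Fw F(3)[OF z(2,3)] s by (auto simp: plane_form_eq_0_iff)
  have Hv: "H v = 0 \<or> H v = J v" if "v \<in> V" "v \<noteq> z" for v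
    using H(2) Hw that by (cases "v = w") auto
  show "H = 0"
  proof (cases "H z = 0")
    case True
    then show ?thesis using Hv H(1) by (intro complementaryD[OF J]) metis+
  next
    case False
    then have Hz: "H z = F z" using H(2) z by auto
    \<comment> \<open>Adding \<open>F\<close> cancels the value at \<open>z\<close> and leads back
      to the choice \<open>J\<close>; but \<open>H + F\<close> is nonzero at
      \<open>w\<close>.\<close>
    have "H + F = 0"
    proof (rule complementaryD[OF J add[OF H(1) F(1)]])
      fix v assume v: "v \<in> V"
      show "(H + F) v = 0 \<or> (H + F) v = J v"
        using Hv[OF v] F(3)[OF v] Hz by (cases "v = z") auto
    qed
    then have "H w + F w = 0" by (metis plus_fun_apply zero_fun_apply)
    then show ?thesis using Hw Fw by simp
  qed
qed

section \<open>Set systems represented by an isotropic system\<close>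

text \<open>\<open>\<alpha> v\<close> stands for absence of \<open>v\<close> and
  \<open>\<beta> v\<close> for its presence. A twist swaps the two, and a loop complementation
  replaces \<open>\<beta> v\<close> by the third nonzero vector.\<close>

definition represents :: "('a \<Rightarrow> bit \<times> bit) \<Rightarrow> ('a \<Rightarrow> bit \<times> bit) \<Rightarrow> 'a set_system \<Rightarrow> bool" where
  "represents \<alpha> \<beta> N \<longleftrightarrow> (\<forall>v \<in> V. \<alpha> v \<noteq> 0 \<and> \<beta> v \<noteq> 0 \<and> \<alpha> v \<noteq> \<beta> v) \<and> ground N = V \<and>
     members N = {Y. Y \<subseteq> V \<and> complementary (\<lambda>v. if v \<in> Y then \<beta> v else \<alpha> v)}"

lemma represents_twist:
  assumes "represents \<alpha> \<beta> N" and "X \<subseteq> V"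
  shows "represents (\<lambda>v. if v \<in> X then \<beta> v else \<alpha> v) (\<lambda>v. if v \<in> X then \<alpha> v else \<beta> v) (twist N X)"
proof -
  have "complementary (\<lambda>v. if v \<in> symdiff Y X then \<beta> v else \<alpha> v) =
    complementary (\<lambda>v. if v \<in> Y then if v \<in> X then \<alpha> v else \<beta> v else if v \<in> X then \<beta> v else \<alpha> v)" for Y
    by (rule complementary_cong) (auto simp: symdiff_def)
  moreover have "symdiff Y X \<subseteq> V \<longleftrightarrow> Y \<subseteq> V" for Y using assms(2) by (auto simp: symdiff_def)
  ultimately have "members (twist N X) = {Y. Y \<subseteq> V \<and> complementary
      (\<lambda>v. if v \<in> Y then if v \<in> X then \<alpha> v else \<beta> v else if v \<in> X then \<beta> v else \<alpha> v)}"
    using assms(1) by (auto simp: mem_twist_iff represents_def)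
  then show ?thesis using assms(1) by (auto simp: represents_def twist_def)
qed

text \<open>By induction on \<open>X\<close>: the parity rule for three lines at \<open>v\<close> is
  the recursion of \<open>mem_loop_compl_insert\<close>.\<close>

lemma represents_loop_compl:
  assumes N: "represents \<alpha> \<beta> N" and X: "X \<subseteq> V"
  shows "represents \<alpha> (\<lambda>v. if v \<in> X then \<alpha> v + \<beta> v else \<beta> v) (loop_compl N X)"
proof -
  have types: "\<alpha> v \<noteq> 0" "\<beta> v \<noteq> 0" "\<alpha> v \<noteq> \<beta> v" if "v \<in> V" for v
    using N that by (auto simp: represents_def)
  have gr: "ground N = V" using N by (simp add: represents_def)
  have ss: "set_system N" using N finite_ground by (auto simp: represents_def set_system_def)
  let ?b = "\<lambda>X v. if v \<in> X then \<alpha> v + \<beta> v else \<beta> v"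
  have "finite X" using X finite_ground by (rule finite_subset)
  then have "Y \<in> members (loop_compl N X) \<longleftrightarrow> complementary (\<lambda>v. if v \<in> Y then ?b X v else \<alpha> v)"
    if "Y \<subseteq> V" for Y
    using X that
  proof (induction X arbitrary: Y rule: finite_induct)
    case empty
    then show ?case using N by (simp add: mem_loop_compl_empty[OF ss] represents_def cong: if_cong)
  next
    case (insert v X)
    show ?case
    proof (cases "v \<in> Y")
      case False
      then have "Y - insert v X = Y - X" by auto
      then have "Y \<in> members (loop_compl N (insert v X)) \<longleftrightarrow> Y \<in> members (loop_compl N X)"
        by (simp add: loop_compl_def)
      also have "\<dots> \<longleftrightarrow> complementary (\<lambda>v. if v \<in> Y then ?b X v else \<alpha> v)"
        using insert by auto
      also have "\<dots> \<longleftrightarrow> complementary (\<lambda>u. if u \<in> Y then ?b (insert v X) u else \<alpha> u)"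
        using False by (intro complementary_cong) auto
      finally show ?thesis .
    next
      case True
      let ?J = "\<lambda>u. if u \<in> Y then ?b X u else \<alpha> u"
      have v: "v \<in> V" using insert by auto
      have J: "?J u \<noteq> 0" if "u \<in> V" for u
        using types[OF that] plane_third(2)[of "\<alpha> u" "\<beta> u"] by auto
      have "Y \<in> members (loop_compl N X) \<longleftrightarrow> complementary (?J(v := \<beta> v))"
        using insert True by (subst insert.IH) (auto intro!: complementary_cong)
      moreover have "Y - {v} \<in> members (loop_compl N X) \<longleftrightarrow> complementary (?J(v := \<alpha> v))"
        using insert by (subst insert.IH) (auto intro!: complementary_cong)
      moreover have "complementary (\<lambda>u. if u \<in> Y then ?b (insert v X) u else \<alpha> u) \<longleftrightarrow>
          complementary (?J(v := \<alpha> v + \<beta> v))"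
        using True by (intro complementary_cong) auto
      ultimately show ?thesis
        using complementary_parity[of v ?J, OF v J types[OF v]]
          mem_loop_compl_insert[OF ss True insert.hyps(2)] insert.prems gr by auto
    qed
  qed
  moreover have "members (loop_compl N X) \<subseteq> Pow V" "ground (loop_compl N X) = V"
    using gr by (auto simp: loop_compl_def)
  moreover have "?b X v \<noteq> 0" "?b X v \<noteq> \<alpha> v" if "v \<in> V" for v
    using types[OF that] plane_third[of "\<alpha> v" "\<beta> v"] by auto
  ultimately show ?thesis using types by (auto simp: represents_def)
qed

text \<open>A member \<open>Y\<close> of largest size containing \<open>v\<close> is turned into one
  of the same size avoiding \<open>v\<close>, by exchanging \<open>v\<close> for some
  \<open>u\<close> outside \<open>Y\<close>. The vector \<open>E\<close> supplies
  \<open>u\<close>.\<close>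

lemma represents_not_coloop:
  assumes N: "represents \<alpha> \<beta> N" and pr: "proper N"
    and E: "E \<in> L" "\<And>u. u \<in> V \<Longrightarrow> E u = 0 \<or> E u = \<beta> u" and v: "v \<in> V" "E v \<noteq> 0"
  shows "\<not> coloop (max_members N) v"
proof -
  let ?J = "\<lambda>Y v. if v \<in> Y then \<beta> v else \<alpha> v"
  have types: "\<alpha> v \<noteq> 0" "\<beta> v \<noteq> 0" "\<alpha> v \<noteq> \<beta> v" if "v \<in> V" for v
    using N that by (auto simp: represents_def)
  have mem: "Y \<in> members N \<longleftrightarrow> Y \<subseteq> V \<and> complementary (?J Y)" for Y
    using N by (simp add: represents_def)
  have finN: "finite (members N)" using finite_ground mem
    by (intro finite_subset[of "members N" "Pow V"]) auto
  have fin: "finite Z" if "Z \<in> members N" for Z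
    using that mem finite_ground finite_subset by blast
  define m where "m = Max (card ` members N)"
  have "m \<in> card ` members N" unfolding m_def
    using finN pr by (intro Max_in) (auto simp: proper_def)
  then obtain Y where Y: "Y \<in> members N" "card Y = m" by auto
  have le: "card Z \<le> m" if "Z \<in> members N" for Z
    unfolding m_def using finN that by (intro Max_ge) auto
  have top: "Z \<in> members (max_members N)" if "Z \<in> members N" "card Z = m" for Z
    using that le fin by (auto simp: max_members_def) (metis card_seteq)+
  have "\<exists>Z \<in> members N. card Z = m \<and> v \<notin> Z"
  proof (cases "v \<in> Y")
    case False
    then show ?thesis using Y by auto
  next
    case vY: True
    have J: "complementary (?J Y)" and YV: "Y \<subseteq> V" using Y mem by auto
    obtain F where F: "F \<in> L" "F v \<noteq> 0" "\<And>u. u \<in> V \<Longrightarrow> u \<noteq> v \<Longrightarrow> F u = 0 \<or> F u = ?J Y u"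
      using ex_vector_off[of v "?J Y", OF v(1)] types by (metis (mono_tags, lifting))
    have Fv: "F v \<noteq> \<beta> v"
    proof
      assume "F v = \<beta> v"
      then have "F = 0" using F vY by (intro complementaryD[OF J]) metis+
      then show False using F(2) by simp
    qed
    \<comment> \<open>\<open>E\<close> and \<open>F\<close> are orthogonal overall but not at
      \<open>v\<close>, so they also clash at some other \<open>u\<close>; there \<open>E u\<close>
      is \<open>\<beta> u\<close> and \<open>F u\<close> is not, which puts \<open>u\<close> outside
      \<open>Y\<close>.\<close>
    have "plane_form (E v) (F v) \<noteq> 0"
      using E(2)[OF v(1)] v(2) F(2) Fv unfolding plane_form_eq_0_iff by auto
    then obtain u where u: "u \<in> V" "u \<noteq> v" "plane_form (E u) (F u) \<noteq> 0"
      using isotropic_at[OF E(1) F(1) v(1)] by blast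
    have Eu: "E u = \<beta> u" "F u \<noteq> 0" "F u \<noteq> \<beta> u"
      using u(3) E(2)[OF u(1)] unfolding plane_form_eq_0_iff by auto
    then have uY: "u \<notin> Y" using F(3)[OF u(1,2)] by auto
    have piv: "complementary ((?J Y)(v := F v, u := \<beta> u))"
      using complementary_pivot[OF v(1) u(1,2) J F Eu(2), of "\<beta> u"] uY types[OF u(1)] by auto
    let ?K = "?J (insert u Y)"
    have K: "?K w \<noteq> 0" if "w \<in> V" for w using types[OF that] by auto
    \<comment> \<open>Here the largest size of \<open>Y\<close> enters: with \<open>u\<close> added,
      \<open>\<beta> v\<close> is not admissible at \<open>v\<close>.\<close>
    have "insert u Y \<notin> members N" using le[of "insert u Y"] Y fin uY by auto
    moreover have "?K(v := \<beta> v) = ?K" using vY by (auto simp: fun_eq_iff)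
    ultimately have nK: "\<not> complementary (?K(v := \<beta> v))"
      using mem[of "insert u Y"] u YV by auto
    have "(?J Y)(v := F v, u := \<beta> u) = ?K(v := F v)" using u by (auto simp: fun_eq_iff)
    with piv have pK: "complementary (?K(v := F v))" by simp
    \<comment> \<open>\<open>F v\<close> is admissible and \<open>\<beta> v\<close> is not, so by
      parity the remaining admissible value includes \<open>\<alpha> v\<close>.\<close>
    have "complementary (?K(v := \<alpha> v))"
    proof (cases "F v = \<alpha> v")
      case True
      then show ?thesis using pK by simp
    next
      case False
      then have "F v = \<alpha> v + \<beta> v"
        using plane_third(1)[OF types[OF v(1)], of "F v"] F(2) Fv by auto
      then show ?thesis
        using complementary_parity[of v ?K, OF v(1) K types[OF v(1)]] pK nK by auto
    qed
    moreover have "?K(v := \<alpha> v) = ?J (insert u (Y - {v}))" using u by (auto simp: fun_eq_iff)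
    ultimately have "insert u (Y - {v}) \<in> members N" using mem u YV by auto
    moreover have "card (insert u (Y - {v})) = m" "v \<notin> insert u (Y - {v})"
      using u uY vY Y fin[OF Y(1)] card_Suc_Diff1[OF fin[OF Y(1)] vY] by auto
    ultimately show ?thesis by blast
  qed
  then show ?thesis using top by (auto simp: coloop_def)
qed

end

subsection \<open>Binary matroids\<close>

text \<open>Recovers bases from independence, which is what a binary representation describes;
  exchange makes the bases an antichain.\<close>

lemma matroid_member_iff:
  assumes M: "matroid M"
  shows "B \<in> members M \<longleftrightarrow> B \<subseteq> ground M \<and> matroid_indep M B \<and>
    (\<forall>u \<in> ground M - B. \<not> matroid_indep M (insert u B))"
proof -
  have sub: "B \<subseteq> ground M" if "B \<in> members M" for B
    using M that by (auto simp: matroid_def set_system_def)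
  have anti: "B = B'" if B: "B \<in> members M" "B' \<in> members M" "B \<subseteq> B'" for B B'
  proof (rule ccontr)
    assume "B \<noteq> B'"
    then obtain x where "x \<in> B' - B" using B by auto
    then obtain y where "y \<in> B - B'" using M B unfolding matroid_def by blast
    then show False using B by auto
  qed
  show ?thesis
  proof
    assume B: "B \<in> members M"
    have "u \<in> B" if "matroid_indep M (insert u B)" for u
      using that anti[OF B] by (auto simp: matroid_indep_def)
    then show "B \<subseteq> ground M \<and> matroid_indep M B \<and>
        (\<forall>u \<in> ground M - B. \<not> matroid_indep M (insert u B))"
      using B sub by (auto simp: matroid_indep_def)
  next
    assume B: "B \<subseteq> ground M \<and> matroid_indep M B \<and>
        (\<forall>u \<in> ground M - B. \<not> matroid_indep M (insert u B))"
    then obtain B' where B': "B' \<in> members M" "B \<subseteq> B'" by (auto simp: matroid_indep_def)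
    have "u \<in> B" if "u \<in> B'" for u
      using B B' sub[OF B'(1)] that unfolding matroid_indep_def by blast
    then have "B = B'" using B' by auto
    then show "B \<in> members M" using B' by simp
  qed
qed

text \<open>With coefficients 0 and 1 a linear combination is a subset sum. Injectivity is the case
  of two-element subsets, since equal columns add to zero.\<close>

lemma columns_indep_iff:
  assumes "finite I"
  shows "columns_indep A I \<longleftrightarrow> (\<forall>X \<subseteq> I. (\<Sum>v\<in>X. A v) = 0 \<longrightarrow> X = {})"
proof -
  interpret vs: vector_space "gf2_scale :: bit \<Rightarrow> (nat \<Rightarrow> bit) \<Rightarrow> nat \<Rightarrow> bit"
    by (rule vector_space_gf2)
  have one: "gf2_scale 1 x = x" and nil: "gf2_scale 0 x = 0" for x :: "nat \<Rightarrow> bit"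
    by (simp_all add: gf2_scale_def fun_eq_iff)
  show ?thesis
  proof
    assume ind: "columns_indep A I"
    show "\<forall>X \<subseteq> I. (\<Sum>v\<in>X. A v) = 0 \<longrightarrow> X = {}"
    proof (intro allI impI)
      fix X assume X: "X \<subseteq> I" "(\<Sum>v\<in>X. A v) = 0"
      have inj: "inj_on A X" using ind X by (auto simp: columns_indep_def inj_on_subset)
      have sum: "(\<Sum>a\<in>A ` X. gf2_scale 1 a) = 0"
        using X(2) by (simp add: one sum.reindex[OF inj])
      have "finite (A ` X)" "A ` X \<subseteq> A ` I" using X assms finite_subset by auto
      then have "vs.dependent (A ` I)" if "X \<noteq> {}"
        unfolding vs.dependent_explicit using that sum
        by (intro exI[of _ "A ` X"] exI[of _ "\<lambda>_. 1"]) auto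
      then show "X = {}" using ind by (auto simp: columns_indep_def)
    qed
  next
    assume R: "\<forall>X \<subseteq> I. (\<Sum>v\<in>X. A v) = 0 \<longrightarrow> X = {}"
    have inj: "inj_on A I"
    proof (rule inj_onI, rule ccontr)
      fix v w assume vw: "v \<in> I" "w \<in> I" "A v = A w" "v \<noteq> w"
      then have "(\<Sum>u\<in>{v, w}. A u) = 0" by (simp add: fun_eq_iff)
      then show False using R[rule_format, of "{v, w}"] vw by auto
    qed
    moreover have "\<not> vs.dependent (A ` I)"
    proof
      assume "vs.dependent (A ` I)"
      then obtain t u where t: "finite t" "t \<subseteq> A ` I" "(\<Sum>a\<in>t. gf2_scale (u a) a) = 0" "\<exists>a\<in>t. u a \<noteq> 0"
        unfolding vs.dependent_explicit by blast
      \<comment> \<open>The elements whose columns have coefficient 1 in the dependency.\<close>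
      define X where "X = {v \<in> I. A v \<in> t \<and> u (A v) = 1}"
      have AX: "A ` X = {a \<in> t. u a = 1}" using t(2) by (auto simp: X_def)
      have "(\<Sum>v\<in>X. A v) = (\<Sum>a\<in>A ` X. a)"
        using inj by (subst sum.reindex) (auto simp: X_def inj_on_def)
      also have "\<dots> = (\<Sum>a\<in>t. gf2_scale (u a) a)"
        unfolding AX using t(1) by (intro sum.mono_neutral_cong_left) (auto simp: one nil)
      finally have "(\<Sum>v\<in>X. A v) = 0" unfolding t(3) .
      moreover have "X \<subseteq> I" by (auto simp: X_def)
      ultimately have "X = {}" using R by (simp only: simp_thms)
      then show False using AX t(4) by auto
    qed
    ultimately show "columns_indep A I" by (simp add: columns_indep_def)
  qed
qed

lemma incidence_support: "incidence {v. f v = 1} = f"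
  by (auto simp: incidence_def fun_eq_iff)

text \<open>Of the representing matrix only its kernel \<open>U\<close> is kept: a set is
  independent iff it supports no nonzero vector of \<open>U\<close>.\<close>

locale binary_matroid_cycles =
  fixes M :: "'a set_system" and U :: "('a \<Rightarrow> bit) set"
  assumes matroid: "matroid M"
    and cycles_zero: "0 \<in> U"
    and cycles_add: "f \<in> U \<Longrightarrow> g \<in> U \<Longrightarrow> f + g \<in> U"
    and cycles_supp: "f \<in> U \<Longrightarrow> v \<notin> ground M \<Longrightarrow> f v = 0"
    and indep_iff: "I \<subseteq> ground M \<Longrightarrow>
      matroid_indep M I \<longleftrightarrow> (\<forall>f \<in> U. (\<forall>v. v \<notin> I \<longrightarrow> f v = 0) \<longrightarrow> f = 0)"

lemma binary_matroid_cycles: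
  fixes M :: "'a set_system"
  assumes "binary_matroid M"
  obtains U where "binary_matroid_cycles M U"
proof -
  let ?V = "ground M"
  from assms obtain A :: "'a \<Rightarrow> nat \<Rightarrow> bit" where M: "matroid M"
    and A: "\<And>I. I \<subseteq> ?V \<Longrightarrow> matroid_indep M I \<longleftrightarrow> columns_indep A I"
    unfolding binary_matroid_def by blast
  have fin: "finite ?V" using M by (simp add: matroid_def set_system_def)
  define U where "U = {f. (\<forall>v. v \<notin> ?V \<longrightarrow> f v = 0) \<and> (\<forall>i. (\<Sum>v\<in>?V. f v * A v i) = 0)}"
  have sum_incidence: "(\<Sum>v\<in>?V. incidence X v * A v i) = (\<Sum>v\<in>X. A v) i" if "X \<subseteq> ?V" for X i
  proof -
    have "(\<Sum>v\<in>X. A v) i = (\<Sum>v\<in>X. A v i)"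
      by (induction X rule: infinite_finite_induct) auto
    also have "\<dots> = (\<Sum>v\<in>?V. incidence X v * A v i)"
      using that fin by (intro sum.mono_neutral_cong_left) (auto simp: incidence_def)
    finally show ?thesis by simp
  qed
  have incU: "incidence X \<in> U \<longleftrightarrow> (\<Sum>v\<in>X. A v) = 0" if "X \<subseteq> ?V" for X
    using that sum_incidence[OF that] by (auto simp: U_def fun_eq_iff incidence_def)
  have "binary_matroid_cycles M U"
  proof
    fix I assume I: "I \<subseteq> ?V"
    have "(\<forall>X \<subseteq> I. (\<Sum>v\<in>X. A v) = 0 \<longrightarrow> X = {}) \<longleftrightarrow> (\<forall>f \<in> U. (\<forall>v. v \<notin> I \<longrightarrow> f v = 0) \<longrightarrow> f = 0)"
      (is "?L \<longleftrightarrow> ?R")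
    proof
      assume L: ?L
      show ?R
      proof (intro ballI impI)
        fix f assume f: "f \<in> U" "\<forall>v. v \<notin> I \<longrightarrow> f v = 0"
        have X: "{v. f v = 1} \<subseteq> I" using f by force
        have "(\<Sum>v\<in>{v. f v = 1}. A v) = 0"
          using f(1) incU[of "{v. f v = 1}"] X I by (auto simp: incidence_support)
        then have "{v. f v = 1} = {}" using L X by blast
        then show "f = 0" by (auto simp: fun_eq_iff)
      qed
    next
      assume R: ?R
      show ?L
      proof (intro allI impI)
        fix X assume X: "X \<subseteq> I" "(\<Sum>v\<in>X. A v) = 0"
        then have "incidence X \<in> U" using incU I by blast
        moreover have "\<forall>v. v \<notin> I \<longrightarrow> incidence X v = 0" using X by (auto simp: incidence_def)
        ultimately have "incidence X = 0" using R by blast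
        then show "X = {}" by (auto simp: incidence_def fun_eq_iff)
      qed
    qed
    then show "matroid_indep M I \<longleftrightarrow> (\<forall>f \<in> U. (\<forall>v. v \<notin> I \<longrightarrow> f v = 0) \<longrightarrow> f = 0)"
      using A[OF I] columns_indep_iff[of I A] finite_subset[OF I fin] by simp
  qed (use M in \<open>auto simp: U_def distrib_right sum.distrib\<close>)
  then show ?thesis by (rule that)
qed

section \<open>The isotropic system of a binary matroid\<close>

context binary_matroid_cycles
begin

abbreviation "V \<equiv> ground M"

definition cocycles :: "('a \<Rightarrow> bit) set" where
  "cocycles = {f. (\<forall>v. v \<notin> V \<longrightarrow> f v = 0) \<and> (\<forall>g \<in> U. (\<Sum>v\<in>V. f v * g v) = 0)}"

definition fundamental :: "('a \<Rightarrow> bit \<times> bit) set" where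
  "fundamental = {p. fst \<circ> p \<in> cocycles \<and> snd \<circ> p \<in> U}"

lemma finite_V: "finite V"
  using matroid by (simp add: matroid_def set_system_def)

lemma support_subset: "f \<in> U \<Longrightarrow> {v. f v = 1} \<subseteq> V"
  using cycles_supp by force

text \<open>A dependent \<open>C\<close> supports a nonzero vector of \<open>U\<close>. The support
  of that vector is itself dependent, so minimality makes it all of \<open>C\<close>.\<close>

lemma incidence_circuit:
  assumes C: "circuit M C"
  shows "incidence C \<in> U"
proof -
  have CV: "C \<subseteq> V" using C by (simp add: circuit_def)
  then obtain f where f: "f \<in> U" "\<And>v. v \<notin> C \<Longrightarrow> f v = 0" "f \<noteq> 0"
    using C indep_iff[OF CV] by (auto simp: circuit_def)
  let ?X = "{v. f v = 1}"
  have "?X \<subseteq> C" using f(2) by force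
  moreover have "\<not> matroid_indep M ?X"
    using indep_iff[OF support_subset[OF f(1)]] f(1,3) by auto
  ultimately have "?X = C" using C unfolding circuit_def by blast
  then show ?thesis using f(1) incidence_support[of f] by simp
qed

lemma ex_circuit_subset:
  assumes X: "X \<subseteq> V" "\<not> matroid_indep M X"
  obtains C where "circuit M C" "C \<subseteq> X"
proof -
  have "finite X" using X(1) finite_V by (rule finite_subset)
  then show thesis using X that
  proof (induction X arbitrary: thesis rule: finite_psubset_induct)
    case (psubset X)
    show ?case
    proof (cases "\<exists>I. I \<subset> X \<and> \<not> matroid_indep M I")
      case True
      then obtain I where I: "I \<subset> X" "\<not> matroid_indep M I" by blast
      then obtain C where "circuit M C" "C \<subseteq> I" using psubset.IH[OF I(1)] psubset.prems(1) by blast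
      then show ?thesis using psubset.prems(3) I(1) by blast
    next
      case False
      then have "circuit M X" using psubset.prems by (auto simp: circuit_def)
      then show ?thesis using psubset.prems(3) by blast
    qed
  qed
qed

text \<open>Identifies \<open>U\<close> with the span of the circuits: a nonempty support in
  \<open>U\<close> contains a circuit, and removing it leaves a smaller support in
  \<open>U\<close>.\<close>

lemma mem_cycle_space_iff: "X \<in> cycle_space M \<longleftrightarrow> X \<subseteq> V \<and> incidence X \<in> U"
proof -
  interpret vs: vector_space "gf2_scale :: bit \<Rightarrow> ('a \<Rightarrow> bit) \<Rightarrow> 'a \<Rightarrow> bit"
    by (rule vector_space_gf2)
  let ?C = "incidence ` {C. circuit M C}"
  have "gf2_scale c f \<in> U" if "f \<in> U" for c f
  proof (cases "c = 0")
    case True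
    then have "gf2_scale c f = 0" by (simp add: gf2_scale_def fun_eq_iff)
    then show ?thesis using cycles_zero by (simp only:)
  next
    case False
    then have "gf2_scale c f = f" by (simp add: gf2_scale_def fun_eq_iff)
    then show ?thesis using that by simp
  qed
  then have "vs.subspace U" using cycles_zero cycles_add by (auto simp: vs.subspace_def)
  then have sub: "vs.span ?C \<subseteq> U" using incidence_circuit by (intro vs.span_minimal) auto
  have "finite X \<Longrightarrow> X \<subseteq> V \<Longrightarrow> incidence X \<in> U \<Longrightarrow> incidence X \<in> vs.span ?C"
  proof (induction X rule: finite_psubset_induct)
    case (psubset X)
    show ?case
    proof (cases "X = {}")
      case True
      then have "incidence X = 0" by (auto simp: incidence_def fun_eq_iff)
      then show ?thesis using vs.span_zero by (simp only:)
    next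
      case False
      then have "incidence X \<noteq> 0" by (auto simp: incidence_def fun_eq_iff)
      moreover have "\<forall>v. v \<notin> X \<longrightarrow> incidence X v = 0" by (simp add: incidence_def)
      ultimately have "\<not> matroid_indep M X"
        using indep_iff[OF psubset.prems(1)] psubset.prems(2) by blast
      then obtain C where C: "circuit M C" "C \<subseteq> X" using ex_circuit_subset psubset.prems(1) by blast
      have C0: "C \<noteq> {}"
        using C matroid by (auto simp: circuit_def matroid_indep_def matroid_def proper_def)
      have eq: "incidence (X - C) = incidence X + incidence C"
        using C(2) by (auto simp: incidence_def fun_eq_iff)
      have "incidence X = incidence (X - C) + incidence C"
        using C(2) by (auto simp: incidence_def fun_eq_iff)
      moreover have "incidence (X - C) \<in> vs.span ?C"
      proof (rule psubset.IH)
        show "X - C \<subset> X" "X - C \<subseteq> V" using C C0 psubset.prems by auto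
        show "incidence (X - C) \<in> U"
          unfolding eq by (intro cycles_add psubset.prems incidence_circuit C)
      qed
      moreover have "incidence C \<in> vs.span ?C" using C by (intro vs.span_base) auto
      ultimately show ?thesis using vs.span_add by metis
    qed
  qed
  then show ?thesis using sub finite_V finite_subset unfolding cycle_space_def by blast
qed

lemma mem_orth_cycle_space_iff:
  "X \<in> orth_compl V (cycle_space M) \<longleftrightarrow> X \<subseteq> V \<and> incidence X \<in> cocycles"
proof -
  have "(\<forall>Y \<in> cycle_space M. (\<Sum>v\<in>V. incidence X v * incidence Y v) = 0) \<longleftrightarrow>
    (\<forall>g \<in> U. (\<Sum>v\<in>V. incidence X v * g v) = 0)" (is "?L \<longleftrightarrow> ?R")
  proof
    assume L: ?L
    show ?R
    proof
      fix g assume g: "g \<in> U"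
      then have "{v. g v = 1} \<in> cycle_space M"
        using support_subset by (simp add: mem_cycle_space_iff incidence_support)
      then show "(\<Sum>v\<in>V. incidence X v * g v) = 0"
        using L incidence_support[of g] by metis
    qed
  qed (auto simp: mem_cycle_space_iff)
  then show ?thesis by (auto simp: orth_compl_def cocycles_def incidence_def)
qed

lemma cocycles_zero: "0 \<in> cocycles"
  by (simp add: cocycles_def)

text \<open>Maximality is tested on vectors living in one coordinate, a cycle in the second or a
  cocycle in the first.\<close>

sublocale isotropic_system V fundamental
proof
  show "finite V" by (rule finite_V)
  show "0 \<in> fundamental"
    using cycles_zero cocycles_zero by (simp add: fundamental_def comp_def zero_fun_def)
  fix p q assume p: "p \<in> fundamental"
  show "p v = 0" if "v \<notin> V" for v
  proof -
    have "(fst \<circ> p) v = 0" "(snd \<circ> p) v = 0"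
      using p that cycles_supp unfolding fundamental_def cocycles_def by blast+
    then show ?thesis by (simp add: prod_eq_iff)
  qed
  assume q: "q \<in> fundamental"
  have "fst \<circ> (p + q) = (fst \<circ> p) + (fst \<circ> q)" "snd \<circ> (p + q) = (snd \<circ> p) + (snd \<circ> q)"
    by (simp_all add: fun_eq_iff)
  moreover have "(fst \<circ> p) + (fst \<circ> q) \<in> cocycles"
    using p q by (simp add: fundamental_def cocycles_def distrib_right sum.distrib)
  ultimately show "p + q \<in> fundamental"
    using p q cycles_add by (simp add: fundamental_def)
  have orth: "(\<Sum>v\<in>V. fst (p v) * snd (q v)) = 0" if "p \<in> fundamental" "q \<in> fundamental" for p q
    using that by (auto simp: fundamental_def cocycles_def)
  have "(\<Sum>v\<in>V. plane_form (p v) (q v)) =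
      (\<Sum>v\<in>V. fst (p v) * snd (q v)) + (\<Sum>v\<in>V. fst (q v) * snd (p v))"
    by (simp add: plane_form_def sum.distrib mult.commute)
  then show "(\<Sum>v\<in>V. plane_form (p v) (q v)) = 0"
    using orth[OF p q] orth[OF q p] by simp
next
  fix p :: "'a \<Rightarrow> bit \<times> bit"
  assume supp: "\<And>v. v \<notin> V \<Longrightarrow> p v = 0"
    and orth: "\<And>q. q \<in> fundamental \<Longrightarrow> (\<Sum>v\<in>V. plane_form (p v) (q v)) = 0"
  have "fst \<circ> p \<in> cocycles"
  proof -
    have "(\<Sum>v\<in>V. (fst \<circ> p) v * g v) = 0" if "g \<in> U" for g
    proof -
      have "(\<lambda>v. (0, g v)) \<in> fundamental"
        using that cocycles_zero by (simp add: fundamental_def comp_def zero_fun_def)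
      from orth[OF this] show ?thesis by (simp add: plane_form_def)
    qed
    then show ?thesis using supp by (simp add: cocycles_def)
  qed
  \<comment> \<open>The double orthogonal complement of \<open>U\<close> is \<open>U\<close>:
    otherwise separation yields a cocycle not orthogonal to \<open>snd \<circ> p\<close>.\<close>
  moreover have "snd \<circ> p \<in> U"
  proof (rule ccontr)
    assume pU: "snd \<circ> p \<notin> U"
    have p0: "(snd \<circ> p) i = 0" if "i \<notin> V" for i using supp[OF that] by simp
    have "\<exists>w. (\<forall>i. i \<notin> V \<longrightarrow> w i = 0) \<and> (\<forall>f \<in> U. (\<Sum>i\<in>V. w i * f i) = 0) \<and>
        (\<Sum>i\<in>V. w i * (snd \<circ> p) i) = 1"
      by (rule bit_separation) (fact finite_V cycles_zero cycles_add cycles_supp p0 pU)+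
    then obtain w where w: "w \<in> cocycles" "(\<Sum>i\<in>V. w i * snd (p i)) = 1"
      by (auto simp: cocycles_def)
    have "(\<lambda>v. (w v, 0)) \<in> fundamental"
      using w(1) cycles_zero by (simp add: fundamental_def comp_def zero_fun_def)
    from orth[OF this] show False using w(2) by (simp add: plane_form_def mult.commute)
  qed
  ultimately show "p \<in> fundamental" by (simp add: fundamental_def)
qed

text \<open>Complementarity splits by coordinates: no nonzero cycle lies inside \<open>B\<close>,
  which is independence, and no nonzero cocycle vanishes on \<open>B\<close>, which for independent
  \<open>B\<close> is maximality.\<close>

lemma represents_matroid: "represents (\<lambda>_. (1, 0)) (\<lambda>_. (0, 1)) M"
proof -
  have compl: "complementary (\<lambda>v. if v \<in> B then (0, 1) else (1, 0)) \<longleftrightarrow>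
      (\<forall>f \<in> cocycles. (\<forall>v \<in> B. f v = 0) \<longrightarrow> f = 0) \<and>
      (\<forall>g \<in> U. (\<forall>v. v \<notin> B \<longrightarrow> g v = 0) \<longrightarrow> g = 0)" (is "?L \<longleftrightarrow> ?R1 \<and> ?R2")
    if BV: "B \<subseteq> V" for B
  proof (intro iffI conjI ballI impI)
    assume L: ?L
    fix f assume f: "f \<in> cocycles" "\<forall>v \<in> B. f v = 0"
    have "(\<lambda>v. (f v, 0)) = (0 :: 'a \<Rightarrow> bit \<times> bit)"
      using f cycles_zero
      by (intro complementaryD[OF L]) (auto simp: fundamental_def comp_def zero_fun_def zero_prod_def)
    then show "f = 0" by (simp add: fun_eq_iff zero_prod_def)
  next
    assume L: ?L
    fix g assume g: "g \<in> U" "\<forall>v. v \<notin> B \<longrightarrow> g v = 0"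
    have "(\<lambda>v. (0, g v)) = (0 :: 'a \<Rightarrow> bit \<times> bit)"
      using g cocycles_zero
      by (intro complementaryD[OF L]) (auto simp: fundamental_def comp_def zero_fun_def zero_prod_def)
    then show "g = 0" by (simp add: fun_eq_iff zero_prod_def)
  next
    assume R: "?R1 \<and> ?R2"
    show ?L
      unfolding complementary_def
    proof (intro ballI impI)
      fix p assume p: "p \<in> fundamental" "\<forall>v\<in>V. p v = 0 \<or> p v = (if v \<in> B then (0, 1) else (1, 0))"
      have "\<forall>v\<in>B. (fst \<circ> p) v = 0"
      proof
        fix v assume "v \<in> B"
        then have "v \<in> V" using BV by auto
        then show "(fst \<circ> p) v = 0" using p(2)[rule_format, of v] \<open>v \<in> B\<close> by auto
      qed
      then have 1: "fst \<circ> p = 0" using R p(1) by (auto simp: fundamental_def)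
      have "\<forall>v. v \<notin> B \<longrightarrow> (snd \<circ> p) v = 0"
      proof (intro allI impI)
        fix v assume "v \<notin> B"
        then show "(snd \<circ> p) v = 0" using p(2)[rule_format, of v] supp[OF p(1), of v]
          by (cases "v \<in> V") auto
      qed
      then have 2: "snd \<circ> p = 0" using R p(1) by (auto simp: fundamental_def)
      show "p = 0"
      proof
        fix v
        show "p v = 0 v" using fun_cong[OF 1, of v] fun_cong[OF 2, of v] by (simp add: prod_eq_iff)
      qed
    qed
  qed
  have "B \<in> members M \<longleftrightarrow> complementary (\<lambda>v. if v \<in> B then (0, 1) else (1, 0))" if BV: "B \<subseteq> V" for B
  proof -
    have "(\<forall>u \<in> V - B. \<not> matroid_indep M (insert u B)) \<longleftrightarrow>
      (\<forall>f \<in> cocycles. (\<forall>v \<in> B. f v = 0) \<longrightarrow> f = 0)" (is "?L \<longleftrightarrow> ?R") if B: "matroid_indep M B"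
    proof
      assume L: ?L
      show ?R
      proof (intro ballI impI, rule ccontr)
        fix f assume f: "f \<in> cocycles" "\<forall>v \<in> B. f v = 0" "f \<noteq> 0"
        then obtain u where u: "f u = 1" by (auto simp: fun_eq_iff)
        then have uV: "u \<in> V - B" using f by (force simp: cocycles_def)
        then have "insert u B \<subseteq> V" using BV by auto
        then obtain g where g: "g \<in> U" "\<And>v. v \<notin> insert u B \<Longrightarrow> g v = 0" "g \<noteq> 0"
          using L uV indep_iff[of "insert u B"] by blast
        have gu: "g u = 1"
        proof (rule ccontr)
          assume "g u \<noteq> 1"
          then have "g v = 0" if "v \<notin> B" for v using g(2)[of v] that by (cases "v = u") auto
          then show False using B indep_iff[OF BV] g by blast
        qed
        \<comment> \<open>The cocycle \<open>f\<close> vanishes on \<open>B\<close> and the cycle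
          \<open>g\<close> outside \<open>insert u B\<close>, so their supports meet in
          \<open>u\<close> alone, against orthogonality.\<close>
        have "(\<Sum>v\<in>V. f v * g v) = f u * g u"
        proof -
          have "(\<Sum>v\<in>V - {u}. f v * g v) = 0"
          proof (intro sum.neutral ballI)
            fix v assume "v \<in> V - {u}"
            then show "f v * g v = 0" using f(2) g(2)[of v] by (cases "v \<in> B") auto
          qed
          then show ?thesis using uV finite_V by (subst sum.remove[of _ u]) auto
        qed
        then show False using f(1) g(1) u gu by (simp add: cocycles_def)
      qed
    next
      assume R: ?R
      show ?L
      proof (intro ballI notI)
        fix u assume u: "u \<in> V - B" and ind: "matroid_indep M (insert u B)"
        \<comment> \<open>\<open>S\<close> is the sum of \<open>U\<close> and all vectors supported
          on \<open>B\<close>. Separating the unit vector at \<open>u\<close> from it gives a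
          cocycle that vanishes on \<open>B\<close> but not at \<open>u\<close>.\<close>
        define S where "S = {f. (\<forall>v. v \<notin> V \<longrightarrow> f v = 0) \<and> (\<exists>g \<in> U. \<forall>v. v \<notin> B \<longrightarrow> f v = g v)}"
        define e :: "'a \<Rightarrow> bit" where "e = incidence {u}"
        have eS: "e \<notin> S"
        proof
          assume "e \<in> S"
          then obtain g where g: "g \<in> U" "\<And>v. v \<notin> B \<Longrightarrow> e v = g v" by (auto simp: S_def)
          have "g v = 0" if "v \<notin> insert u B" for v
            using g(2)[of v] that by (simp add: e_def incidence_def)
          moreover have "insert u B \<subseteq> V" using u BV by auto
          ultimately have "g = 0" using ind g(1) indep_iff[of "insert u B"] by simp
          then show False using g(2)[of u] u by (auto simp: e_def incidence_def)
        qed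
        have Sadd: "f + g \<in> S" if fg: "f \<in> S" "g \<in> S" for f g
        proof -
          obtain f' g' where f': "f' \<in> U" "\<And>v. v \<notin> B \<Longrightarrow> f v = f' v"
            and g': "g' \<in> U" "\<And>v. v \<notin> B \<Longrightarrow> g v = g' v" using fg by (auto simp: S_def)
          have "\<forall>v. v \<notin> B \<longrightarrow> (f + g) v = (f' + g') v" using f' g' by simp
          moreover have "\<forall>v. v \<notin> V \<longrightarrow> (f + g) v = 0" using fg by (simp add: S_def)
          ultimately show ?thesis using cycles_add[OF f'(1) g'(1)] unfolding S_def by blast
        qed
        have S0: "0 \<in> S" unfolding S_def using cycles_zero by (intro CollectI conjI bexI[of _ 0]) auto
        have Ssupp: "f v = 0" if "f \<in> S" "v \<notin> V" for f v using that by (simp add: S_def)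
        have esupp: "e v = 0" if "v \<notin> V" for v using that u by (auto simp: e_def incidence_def)
        have "\<exists>w. (\<forall>i. i \<notin> V \<longrightarrow> w i = 0) \<and> (\<forall>f \<in> S. (\<Sum>i\<in>V. w i * f i) = 0) \<and>
            (\<Sum>i\<in>V. w i * e i) = 1"
          by (rule bit_separation) (fact finite_V S0 Sadd Ssupp esupp eS)+
        then obtain w where w: "\<forall>i. i \<notin> V \<longrightarrow> w i = 0" "\<forall>f \<in> S. (\<Sum>i\<in>V. w i * f i) = 0"
          "(\<Sum>i\<in>V. w i * e i) = 1" by blast
        have "U \<subseteq> S" using cycles_supp by (auto simp: S_def)
        then have "w \<in> cocycles" using w by (auto simp: cocycles_def)
        moreover have "w v = 0" if "v \<in> B" for v
        proof -
          have "incidence {v} \<in> S" unfolding S_def using that BV cycles_zero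
            by (intro CollectI conjI bexI[of _ 0]) (auto simp: incidence_def)
          then have "(\<Sum>i\<in>V. w i * incidence {v} i) = 0" using w(2) by blast
          moreover have "(\<Sum>i\<in>V. w i * incidence {v} i) = w v"
            using that BV finite_V by (subst sum.remove[of _ v]) (auto simp: incidence_def)
          ultimately show ?thesis by simp
        qed
        ultimately have "w = 0" using R by blast
        then show False using w(3) by simp
      qed
    qed
    then show ?thesis
      unfolding matroid_member_iff[OF matroid] compl[OF BV] using BV indep_iff[OF BV] by blast
  qed
  moreover have "members M \<subseteq> Pow V" using matroid by (simp add: matroid_def set_system_def)
  ultimately show ?thesis unfolding represents_def by (auto simp: zero_prod_def)
qed

section \<open>The tripartition in terms of cycles and cocycles\<close>

lemma fundamental_incidence:
  assumes "X \<in> orth_compl V (cycle_space M)" "Y \<in> cycle_space M"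
  shows "(\<lambda>v. (incidence X v, incidence Y v)) \<in> fundamental"
  using assms
  by (simp add: fundamental_def comp_def mem_cycle_space_iff mem_orth_cycle_space_iff)

lemma fundamental_supports:
  assumes "p \<in> fundamental"
  shows "{v. fst (p v) = 1} \<in> orth_compl V (cycle_space M)" "{v. snd (p v) = 1} \<in> cycle_space M"
proof -
  have p: "fst \<circ> p \<in> cocycles" "snd \<circ> p \<in> U" using assms by (auto simp: fundamental_def)
  have "{v. (fst \<circ> p) v = 1} \<subseteq> V" using p by (force simp: cocycles_def)
  then show "{v. fst (p v) = 1} \<in> orth_compl V (cycle_space M)"
    using p(1) incidence_support[of "fst \<circ> p"] by (simp add: mem_orth_cycle_space_iff)
  show "{v. snd (p v) = 1} \<in> cycle_space M"
    using p(2) support_subset[OF p(2)] incidence_support[of "snd \<circ> p"]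
    by (simp add: mem_cycle_space_iff)
qed

text \<open>Take \<open>F\<close> with values 0 or \<open>(1, 1)\<close> away from \<open>v\<close>.
  Its two supports differ at most at \<open>v\<close>, and the three nonzero values there are the
  three cases.\<close>

lemma tripartition_cover:
  assumes v: "v \<in> V"
  shows "(\<exists>X \<in> cycle_space M. v \<in> X \<and> X - {v} \<in> orth_compl V (cycle_space M)) \<or>
    (\<exists>X \<in> orth_compl V (cycle_space M). v \<in> X \<and> X - {v} \<in> cycle_space M) \<or>
    (\<exists>X \<in> cycle_space M \<inter> orth_compl V (cycle_space M). v \<in> X)"
proof -
  obtain F where F: "F \<in> fundamental" "F v \<noteq> 0"
    "\<And>u. u \<in> V \<Longrightarrow> u \<noteq> v \<Longrightarrow> F u = 0 \<or> F u = (1, 1)"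
    using ex_vector_off[of v "\<lambda>_. (1, 1)", OF v] by (auto simp: zero_prod_def)
  let ?X = "{u. fst (F u) = 1}" and ?Y = "{u. snd (F u) = 1}"
  have eq: "fst (F u) = snd (F u)" if "u \<noteq> v" for u
    using F(3)[of u] supp[OF F(1), of u] that by (cases "u \<in> V") auto
  note sup = fundamental_supports[OF F(1)]
  consider "fst (F v) = 0" "snd (F v) = 1" | "fst (F v) = 1" "snd (F v) = 0"
    | "fst (F v) = 1" "snd (F v) = 1"
    using F(2) by (cases "fst (F v)"; cases "snd (F v)") (auto simp: prod_eq_iff)
  then show ?thesis
  proof cases
    case 1
    have "u \<in> ?Y - {v} \<longleftrightarrow> u \<in> ?X" for u using eq[of u] 1 by (cases "u = v") auto
    then have "?Y - {v} = ?X" by blast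
    then show ?thesis using sup 1 by (intro disjI1 bexI[of _ ?Y]) simp_all
  next
    case 2
    have "u \<in> ?X - {v} \<longleftrightarrow> u \<in> ?Y" for u using eq[of u] 2 by (cases "u = v") auto
    then have "?X - {v} = ?Y" by blast
    then show ?thesis using sup 2 by (intro disjI2[OF disjI1] bexI[of _ ?X]) simp_all
  next
    case 3
    have "u \<in> ?X \<longleftrightarrow> u \<in> ?Y" for u using eq[of u] 3 by (cases "u = v") auto
    then have "?X = ?Y" by blast
    then show ?thesis using sup 3 by (intro disjI2[OF disjI2] bexI[of _ ?X]) simp_all
  qed
qed

text \<open>After loop complementation on \<open>V\<close>, presence is encoded by
  \<open>(1, 1)\<close> everywhere. At \<open>v\<close> a further loop complementation turns this
  into \<open>(0, 1)\<close>, a twist into \<open>(1, 0)\<close>. Pairing the given cocycle and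
  cycle yields a vector with exactly these values, as \<open>represents_not_coloop\<close> requires;
  vf-safety supplies properness.\<close>

lemma tripartition_not_coloop:
  assumes M: "vf_safe M" and v: "v \<in> V"
  shows "X \<in> cycle_space M \<Longrightarrow> v \<in> X \<Longrightarrow> X - {v} \<in> orth_compl V (cycle_space M) \<Longrightarrow>
      \<not> coloop (max_members (loop_compl (loop_compl M V) {v})) v"
    and "X \<in> orth_compl V (cycle_space M) \<Longrightarrow> v \<in> X \<Longrightarrow> X - {v} \<in> cycle_space M \<Longrightarrow>
      \<not> coloop (max_members (twist (loop_compl M V) {v})) v"
    and "X \<in> cycle_space M \<Longrightarrow> X \<in> orth_compl V (cycle_space M) \<Longrightarrow> v \<in> X \<Longrightarrow>
      \<not> coloop (max_members (loop_compl M V)) v"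
proof -
  have reach: "vf_reachable M (loop_compl M V)" by (intro vf_reachable.intros) auto
  have pr: "proper N" if "vf_reachable M N" for N
    using M that unfolding vf_safe_def delta_matroid_def by blast
  note rep = represents_loop_compl[OF represents_matroid subset_refl]
  have vV: "{v} \<subseteq> V" using v by simp
  {
    assume X: "X \<in> cycle_space M" "v \<in> X" "X - {v} \<in> orth_compl V (cycle_space M)"
    show "\<not> coloop (max_members (loop_compl (loop_compl M V) {v})) v"
      by (rule represents_not_coloop[OF represents_loop_compl[OF rep vV] _
            fundamental_incidence[OF X(3,1)] _ v])
        (use X v reach in \<open>auto simp: incidence_def zero_prod_def intro!: pr vf_reachable.intros\<close>)
  next
    assume X: "X \<in> orth_compl V (cycle_space M)" "v \<in> X" "X - {v} \<in> cycle_space M"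
    show "\<not> coloop (max_members (twist (loop_compl M V) {v})) v"
      by (rule represents_not_coloop[OF represents_twist[OF rep vV] _
            fundamental_incidence[OF X(1,3)] _ v])
        (use X v reach in \<open>auto simp: incidence_def zero_prod_def intro!: pr vf_reachable.intros\<close>)
  next
    assume X: "X \<in> cycle_space M" "X \<in> orth_compl V (cycle_space M)" "v \<in> X"
    show "\<not> coloop (max_members (loop_compl M V)) v"
      by (rule represents_not_coloop[OF rep _ fundamental_incidence[OF X(2,1)] _ v])
        (use X v reach in \<open>auto simp: incidence_def zero_prod_def intro!: pr\<close>)
  }
qed

end

text \<open>Since the larger sets are disjoint and the smaller ones already cover, one inclusion for
  each pair suffices.\<close>

lemma tripartition_eq:
  assumes "P' \<subseteq> P" "Q' \<subseteq> Q" "R' \<subseteq> R" "P \<union> Q \<union> R \<subseteq> P' \<union> Q' \<union> R'"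
    and "P \<inter> Q = {}" "P \<inter> R = {}" "Q \<inter> R = {}"
  shows "P = P' \<and> Q = Q' \<and> R = R'"
  using assms by blast

theorem theorem4:
  fixes M :: "'a set_system" and V P Q R :: "'a set"
  assumes "vf_safe M"
    and "V = ground M"
    and "P = {v \<in> V. \<not> coloop (max_members (loop_compl (loop_compl M V) {v})) v}"
    and "Q = {v \<in> V. \<not> coloop (max_members (twist (loop_compl M V) {v})) v}"
    and "R = {v \<in> V. \<not> coloop (max_members (loop_compl M V)) v}"
  shows "(\<forall>v \<in> V. (v \<in> P \<and> v \<notin> Q \<and> v \<notin> R) \<or> (v \<notin> P \<and> v \<in> Q \<and> v \<notin> R)
                    \<or> (v \<notin> P \<and> v \<notin> Q \<and> v \<in> R)) \<and>
    (binary_matroid M \<longrightarrow>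
       P = {v \<in> V. \<exists>X \<in> cycle_space M. v \<in> X \<and> X - {v} \<in> orth_compl V (cycle_space M)} \<and>
       Q = {v \<in> V. \<exists>X \<in> orth_compl V (cycle_space M). v \<in> X \<and> X - {v} \<in> cycle_space M} \<and>
       R = {v \<in> V. \<exists>X \<in> cycle_space M \<inter> orth_compl V (cycle_space M). v \<in> X})"
proof -
  have reach: "vf_reachable M (loop_compl M V)"
    using assms(2) by (intro vf_reachable.intros) auto
  have dm: "delta_matroid N" if "vf_reachable M N" for N
    using assms(1) that unfolding vf_safe_def by blast
  have part: "(v \<in> P \<and> v \<notin> Q \<and> v \<notin> R) \<or> (v \<notin> P \<and> v \<in> Q \<and> v \<notin> R) \<or> (v \<notin> P \<and> v \<notin> Q \<and> v \<in> R)"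
    if v: "v \<in> V" for v
  proof -
    have "{v} \<subseteq> ground M" using v assms(2) by simp
    then have "delta_matroid (loop_compl M V)" "delta_matroid (twist (loop_compl M V) {v})"
      "delta_matroid (loop_compl (loop_compl M V) {v})"
      by (intro dm vf_reachable.intros(2,3) reach; assumption)+
    moreover have "v \<in> ground (loop_compl M V)" using v assms(2) by (simp add: loop_compl_def)
    ultimately show ?thesis
      using coloop_trichotomy[of "loop_compl M V" v] v unfolding assms(3-5) by simp
  qed
  have "P = {v \<in> V. \<exists>X \<in> cycle_space M. v \<in> X \<and> X - {v} \<in> orth_compl V (cycle_space M)} \<and>
       Q = {v \<in> V. \<exists>X \<in> orth_compl V (cycle_space M). v \<in> X \<and> X - {v} \<in> cycle_space M} \<and>
       R = {v \<in> V. \<exists>X \<in> cycle_space M \<inter> orth_compl V (cycle_space M). v \<in> X}"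
    (is "P = ?P \<and> Q = ?Q \<and> R = ?R") if bin: "binary_matroid M"
  proof -
    obtain U where "binary_matroid_cycles M U" using binary_matroid_cycles[OF bin] .
    then interpret binary_matroid_cycles M U .
    have sub: "P \<subseteq> V" "Q \<subseteq> V" "R \<subseteq> V" using assms(3-5) by auto
    show ?thesis
    proof (rule tripartition_eq)
      show "?P \<subseteq> P" "?Q \<subseteq> Q" "?R \<subseteq> R"
        using tripartition_not_coloop[OF assms(1)] unfolding assms(2-5) by blast+
      have "v \<in> ?P \<union> ?Q \<union> ?R" if "v \<in> V" for v
        using tripartition_cover[of v] that unfolding assms(2) by blast
      then have "V \<subseteq> ?P \<union> ?Q \<union> ?R" by (rule subsetI)
      then show "P \<union> Q \<union> R \<subseteq> ?P \<union> ?Q \<union> ?R" by (intro Un_least sub[THEN order_trans])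
      show "P \<inter> Q = {}" "P \<inter> R = {}" "Q \<inter> R = {}"
        using part sub(1,2) by (meson disjoint_iff subsetD)+
    qed
  qed
  then show ?thesis by (intro conjI[OF ballI impI]) (rule part)
qed

end
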